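(* Let $F:\mathbb{R}\times\mathbb{R}^n\to\mathbb{R}^n$, let $x=\mathrm{col}[x_1,x_2]$ with $x_1\in\mathbb{R}^{n_1}$, $x_2\in\mathbb{R}^{n_2}$, $n_1+n_2=n$, and let $F=\mathrm{col}[F_1,F_2]$ be partitioned accordingly. Assume the following. (1) The origin of $\dot x=F(t,x)$ is uniformly globally stable (UGS). (2) There exist integers $j,m>0$ and for each $\Delta>0$ there exist a number $\mu>0$, locally Lipschitz continuous functions $V_i:\mathbb{R}\times\mathbb{R}^n\to\mathbb{R}$, $i\in\{1,\dots,j\}$, a continuous function $\phi:\mathbb{R}\times\mathbb{R}^n\to\mathbb{R}^m$, and continuous functions $Y_i:\mathbb{R}^n\times\mathbb{R}^m\to\mathbb{R}$, $i\in\{1,\dots,j\}$, such that for every $i$ and for almost all $(t,x)\in\mathbb{R}\times\mathcal{B}(\Delta)$, $$\max\{|V_i(t,x)|,|\phi(t,x)|\}\le\mu,\qquad \dot V_i(t,x)\le Y_i(x,\phi(t,x)).$$ Moreover, for each $\Delta>0$ the objects in (2) satisfy (3)–(6): (3) For each $k\in\{1,\dots,j\}$: if $(z,\psi)\in\mathcal{B}(\Delta)\times\mathcal{B}(\mu)$ and $Y_i(z,\psi)=0$ for all $i\in\{1,\dots,k-1\}$, then $Y_k(z,\psi)\le0$. (For $k=1$ this means $Y_1(z,\psi)\le0$ for all $(z,\psi)\in\mathcal{B}(\Delta)\times\mathcal{B}(\mu)$.) (4) If $(z,\psi)\in\mathcal{B}(\Delta)\times\mathcal{B}(\mu)$ and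 $Y_i(z,\psi)=0$ for all $i\in\{1,\dots,j\}$, then $z_1=0$ and $\psi_1=0$. (5) The first component $\phi_1$ of $\phi$ is independent of $x_1$, locally Lipschitz in $x_2$ uniformly in $t$, u$\delta$-PE with respect to $x_2$, and zero at the origin. (6) For all $(t,x)\in\mathbb{R}\times\mathcal{B}(\Delta)$, $|F_2(t,x)|\le\rho_\Delta(x_1,\phi_1(t,x))$, where $\rho_\Delta$ is continuous and zero at zero. Then the origin of $\dot x=F(t,x)$ is uniformly globally asymptotically stable (UGAS).
   Context: $|\cdot|$ is the Euclidean norm; $\mathcal{B}(r)$ is the closed ball $\{y:|y|\le r\}$ in the Euclidean space of appropriate dimension. Standing assumption: solutions of $\dot x=F(t,x)$ exist over finite intervals; $x(\cdot,t_\circ,x_\circ)$ denotes a solution with initial condition $(t_\circ,x_\circ)$. Vectors $z\in\mathbb{R}^n$ are partitioned as $z=\mathrm{col}[z_1,z_2]$ like $x$. Vectors $\psi\in\mathbb{R}^m$ and the function $\phi$ are partitioned as $\psi=\mathrm{col}[\psi_1,\psi_2]$, $\phi=\mathrm{col}[\phi_1,\phi_2]$; the "first component" $\phi_1$ is the first block, and its size need not match the size of $x_1$. For a locally Lipschitz $V:\mathbb{R}\times\mathbb{R}^n\to\mathbb{R}$, $\dot V(t,x):=\frac{\partial V}{\partial t}+\frac{\partial V}{\partial x}F(t,x)$ (defined almost everywhere). A function $G(t,x)$ is locally Lipschitz in $x$ uniformly in $t$ if for each $x_0$ there exists $L$ such that $|G(t,x)-G(t,y)|\le L|x-y|$ for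 all $x,y$ in a neighbourhood of $x_0$ and all $t\in\mathbb{R}$. Class $\mathcal{K}_\infty$: continuous strictly increasing unbounded $\gamma:\mathbb{R}_{\ge0}\to\mathbb{R}_{\ge0}$ with $\gamma(0)=0$. UGS: there is $\gamma\in\mathcal{K}_\infty$ such that for each $(t_\circ,x_\circ)\in\mathbb{R}\times\mathbb{R}^n$ each solution satisfies $|x(t,t_\circ,x_\circ)|\le\gamma(|x_\circ|)$ for all $t\ge t_\circ$. Uniform global attractivity: for each $r,\sigma>0$ there is $T>0$ such that $|x_\circ|\le r$ implies $|x(t,t_\circ,x_\circ)|\le\sigma$ for all $t\ge t_\circ+T$ (for all $t_\circ\in\mathbb{R}$, with $T$ independent of $t_\circ$). UGAS: UGS and uniformly globally attractive. A function $\varphi(t,x)$, with $t\mapsto\varphi(t,x)$ locally integrable, is u$\delta$-PE (uniformly $\delta$-persistently exciting) with respect to $x_2$ if for each $x$ with $x_2\ne0$ there exist $\delta>0$, $T>0$, $\mu>0$ such that for all $t\in\mathbb{R}$: $|z-x|\le\delta$ implies $\int_t^{t+T}|\varphi(\tau,z)|\,d\tau\ge\mu$.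
   Formalization: F is also assumed to satisfy the Carathéodory conditions (measurable in t, continuous in x for almost all t, locally bounded by an integrable function of t); without continuity in x the almost-everywhere bound on the derivative of V_i does not control solutions and the claim fails. *)

theory Defs
  imports "HOL-Analysis.Analysis"
begin

text \<open>
  A vector partitioned as \<open>x = col[x\<^sub>1, x\<^sub>2]\<close> is an element of \<open>real ^ 'n\<close> together with the set
  \<open>I\<close> of coordinates that make up \<open>x\<^sub>1\<close>; the coordinates of \<open>x\<^sub>2\<close> are those in \<open>- I\<close>.
  A block is represented by the vector padded with zeros, which has the same Euclidean norm and
  vanishes iff the block does. Unlike a product type, this also allows an empty block.
\<close>

definition block :: "'n set \<Rightarrow> (real ^ 'n) \<Rightarrow> (real ^ 'n)" where
  "block I x = (\<chi> i. if i \<in> I then x $ i else 0)"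

text \<open>
  Solutions are Caratheodory solutions: locally absolutely continuous functions satisfying the
  equation almost everywhere, here in integral form. The domain \<open>J\<close> is any interval with least
  element \<open>t0\<close>, bounded or not.
\<close>

definition solution ::
  "(real \<times> (real ^ 'n::finite) \<Rightarrow> (real ^ 'n)) \<Rightarrow> real set \<Rightarrow> real \<Rightarrow> (real ^ 'n) \<Rightarrow> (real \<Rightarrow> (real ^ 'n)) \<Rightarrow> bool"
  where
  "solution F J t0 x0 x \<longleftrightarrow>
     is_interval J \<and> t0 \<in> J \<and> J \<subseteq> {t0..} \<and>
     (\<forall>t\<in>J. (\<lambda>s. F (s, x s)) absolutely_integrable_on {t0..t} \<and>
            x t = x0 + integral {t0..t} (\<lambda>s. F (s, x s)))"

definition solutions_exist :: "(real \<times> (real ^ 'n::finite) \<Rightarrow> (real ^ 'n)) \<Rightarrow> bool" where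
  "solutions_exist F \<longleftrightarrow> (\<forall>t0 x0. \<exists>b>t0. \<exists>x. solution F {t0..b} t0 x0 x)"

text \<open>
  The Caratheodory conditions. Without continuity of \<open>F\<close> in \<open>x\<close>, an inequality on the orbital
  derivative that holds only for almost all \<open>(t, x)\<close> says nothing about a solution that stays in
  a null set.
\<close>

definition caratheodory :: "(real \<times> (real ^ 'n::finite) \<Rightarrow> (real ^ 'n)) \<Rightarrow> bool" where
  "caratheodory F \<longleftrightarrow>
     (\<forall>x. (\<lambda>t. F (t, x)) \<in> borel_measurable lebesgue) \<and>
     (AE t in lebesgue. continuous_on UNIV (\<lambda>x. F (t, x))) \<and>
     (\<forall>r. \<exists>m :: real \<Rightarrow> real. (\<forall>a b. m absolutely_integrable_on {a..b}) \<and>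
        (AE t in lebesgue. \<forall>x\<in>cball 0 r. norm (F (t, x)) \<le> m t))"

definition class_K_infinity :: "(real \<Rightarrow> real) \<Rightarrow> bool" where
  "class_K_infinity \<gamma> \<longleftrightarrow>
     continuous_on {0..} \<gamma> \<and> strict_mono_on {0..} \<gamma> \<and> \<gamma> 0 = 0 \<and> (\<forall>M. \<exists>s\<ge>0. \<gamma> s > M)"

text \<open>
  The stability notions quantify over solutions on arbitrary intervals \<open>J\<close>, so that solutions which
  are not known to be global are covered too; \<open>J = {t0..}\<close> gives the bound for all \<open>t \<ge> t0\<close>.
\<close>

definition UGS :: "(real \<times> (real ^ 'n::finite) \<Rightarrow> (real ^ 'n)) \<Rightarrow> bool" where
  "UGS F \<longleftrightarrow>
     (\<exists>\<gamma>. class_K_infinity \<gamma> \<and>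
        (\<forall>t0 x0 J x. solution F J t0 x0 x \<longrightarrow> (\<forall>t\<in>J. norm (x t) \<le> \<gamma> (norm x0))))"

definition uniformly_globally_attractive :: "(real \<times> (real ^ 'n::finite) \<Rightarrow> (real ^ 'n)) \<Rightarrow> bool" where
  "uniformly_globally_attractive F \<longleftrightarrow>
     (\<forall>r>0. \<forall>\<sigma>>0. \<exists>T>0. \<forall>t0 x0 J x. solution F J t0 x0 x \<and> norm x0 \<le> r \<longrightarrow>
        (\<forall>t\<in>J. t \<ge> t0 + T \<longrightarrow> norm (x t) \<le> \<sigma>))"

definition UGAS :: "(real \<times> (real ^ 'n::finite) \<Rightarrow> (real ^ 'n)) \<Rightarrow> bool" where
  "UGAS F \<longleftrightarrow> UGS F \<and> uniformly_globally_attractive F"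

definition locally_lipschitz :: "('a::metric_space \<Rightarrow> 'b::metric_space) \<Rightarrow> bool" where
  "locally_lipschitz f \<longleftrightarrow> (\<forall>p. \<exists>u>0. \<exists>L. L-lipschitz_on (cball p u) f)"

definition locally_lipschitz_uniformly ::
  "(real \<times> 'a::metric_space \<Rightarrow> 'b::metric_space) \<Rightarrow> bool" where
  "locally_lipschitz_uniformly G \<longleftrightarrow>
     (\<forall>x0. \<exists>u>0. \<exists>L. \<forall>t. L-lipschitz_on (cball x0 u) (\<lambda>x. G (t, x)))"

text \<open>
  \<open>\<partial>V/\<partial>t + \<partial>V/\<partial>x F\<close>, meaningful at the points where \<open>V\<close> is differentiable (almost all points if
  \<open>V\<close> is locally Lipschitz).
\<close>

definition orbital_derivative ::
  "(real \<times> (real ^ 'n::finite) \<Rightarrow> (real ^ 'n)) \<Rightarrow> (real \<times> (real ^ 'n) \<Rightarrow> real) \<Rightarrow> real \<times> (real ^ 'n) \<Rightarrow> real"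
  where
  "orbital_derivative F V p = frechet_derivative V (at p) (1, F p)"

definition u_delta_PE ::
  "'n set \<Rightarrow> (real \<times> (real ^ 'n::finite) \<Rightarrow> 'b::euclidean_space) \<Rightarrow> bool" where
  "u_delta_PE I2 G \<longleftrightarrow>
     (\<forall>x a b. (\<lambda>t. G (t, x)) absolutely_integrable_on {a..b}) \<and>
     (\<forall>x. block I2 x \<noteq> 0 \<longrightarrow>
        (\<exists>\<delta>>0. \<exists>T>0. \<exists>\<mu>>0. \<forall>t z. norm (z - x) \<le> \<delta> \<longrightarrow>
           integral {t..t + T} (\<lambda>\<tau>. norm (G (\<tau>, z))) \<ge> \<mu>))"

end

theory Submission
  imports Defs
begin

hide_const (open) Polynomial.content

text \<open>
  By uniform stability it is enough to find, for each radius and each bound on the initial states, a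
  time \<open>T\<close> such that every solution within the bound enters the ball of that radius during \<open>[t0, t0 + T]\<close>.

  Let \<open>g\<close> be the sum of the norms of the first block of the state and of \<open>\<phi>\<^sub>1\<close> and of the absolute
  value of \<open>\<rho>\<close>. It vanishes where all \<open>Y i\<close> vanish. As the \<open>Y i\<close> are nested, for every \<open>\<eta> > 0\<close> there
  are weights \<open>c i \<ge> 0\<close> with \<open>g + (\<Sum>i. c i * Y i) < \<eta>\<close> on the relevant compact set
  (\<open>nested_penalty\<close>). Along a solution the integral of \<open>Y i\<close> is at least the increment of \<open>V i\<close>
  (\<open>integral_inequality_along_solution\<close>), and \<open>V i\<close> is bounded. So the integral of \<open>g\<close> over a time
  interval is at most \<open>\<eta>\<close> times its length plus a constant (\<open>integral_dissipation_bound\<close>), and a long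
  interval contains a window of prescribed length on which the average of \<open>g\<close> is at most \<open>2 * \<eta>\<close>.

  On such a window the first block, the speed of the second block, and \<open>\<phi>\<^sub>1\<close> are all small on average.
  The second block is therefore almost constant, so that \<open>\<phi>\<^sub>1\<close> evaluated at a fixed second block is
  small as well, which contradicts persistency of excitation unless the state comes close to the
  origin (\<open>excited_solution_visits_ball\<close>). Excitation and the Lipschitz property of \<open>\<phi>\<^sub>1\<close> are uniform
  on the compact set of second blocks concerned (\<open>uniform_excitation_on_compact\<close>), so the length of
  the window, and with it \<open>\<eta>\<close> and \<open>T\<close>, do not depend on the solution.

  The delicate point is that the inequalities for the orbital derivatives hold for almost all
  \<open>(t, x)\<close>, whereas a solution is a single curve. They are used along almost every translate of the
  solution, and continuity of \<open>F\<close> in the state lets the translation tend to zero.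
\<close>

section \<open>The chain rule along absolutely continuous curves\<close>

lemma lipschitz_derivative_bound:
  fixes V :: "'a::real_normed_vector \<Rightarrow> 'b::real_normed_vector"
  assumes lip: "L-lipschitz_on S V" and p: "p \<in> interior S"
    and der: "(V has_derivative D) (at p)"
  shows "norm (D v) \<le> L * norm v"
proof -
  interpret D: bounded_linear D
    using der by (rule has_derivative_bounded_linear)
  have pS: "p \<in> S" using p interior_subset by blast
  have L0: "0 \<le> L" using lip by (rule lipschitz_on_nonneg)
  have D_le: "norm (D v) \<le> (L + e) * norm v" if e: "e > 0" for e
  proof -
    obtain d1 where d1: "d1 > 0" "ball p d1 \<subseteq> S"
      using p mem_interior by blast
    obtain d2 where d2: "d2 > 0"
      "\<And>q. norm (q - p) < d2 \<Longrightarrow> norm (V q - V p - D (q - p)) \<le> e * norm (q - p)"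
      using der e unfolding has_derivative_at_alt by blast
    define s where "s = min d1 d2 / (2 * (norm v + 1))"
    have s: "s > 0" using d1 d2 by (simp add: s_def add_nonneg_pos)
    have "s * norm v \<le> min d1 d2 / 2 * (norm v / (norm v + 1))"
      by (simp add: s_def field_simps)
    also have "\<dots> \<le> min d1 d2 / 2 * 1"
      using d1 d2 by (intro mult_left_mono) (auto simp: divide_le_eq_1 add_nonneg_pos)
    also have "\<dots> < min d1 d2" using d1 d2 by linarith
    finally have sv: "norm (s *\<^sub>R v) < min d1 d2" using s by simp
    have "p + s *\<^sub>R v \<in> S" using d1 sv by (auto simp: dist_norm subset_iff)
    then have 1: "norm (V (p + s *\<^sub>R v) - V p) \<le> L * norm (s *\<^sub>R v)"
      using lipschitz_onD[OF lip _ pS] by (metis add_diff_cancel_left' dist_norm)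
    have 2: "norm (V (p + s *\<^sub>R v) - V p - D (s *\<^sub>R v)) \<le> e * norm (s *\<^sub>R v)"
      using d2(2)[of "p + s *\<^sub>R v"] sv by simp
    have "norm (D (s *\<^sub>R v)) \<le> L * norm (s *\<^sub>R v) + e * norm (s *\<^sub>R v)"
      using 1 2 norm_triangle_ineq4[of "V (p + s *\<^sub>R v) - V p" "V (p + s *\<^sub>R v) - V p - D (s *\<^sub>R v)"]
      by simp
    then have "s * norm (D v) \<le> s * ((L + e) * norm v)"
      using s by (simp add: D.scaleR algebra_simps)
    then show ?thesis using s by simp
  qed
  show ?thesis
  proof (rule field_le_epsilon)
    fix e :: real assume e: "e > 0"
    have "e / (norm v + 1) > 0" using e by (simp add: add_nonneg_pos)
    from D_le[OF this]
    have "norm (D v) \<le> L * norm v + e * (norm v / (norm v + 1))" by (simp add: algebra_simps)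
    also have "e * (norm v / (norm v + 1)) \<le> e * 1"
      using e by (intro mult_left_mono) (auto simp: divide_le_eq_1 add_nonneg_pos)
    finally show "norm (D v) \<le> L * norm v + e" by simp
  qed
qed

text \<open>
  The chain rule for a Lipschitz function along an absolutely continuous curve, under the assumption
  that \<open>V\<close> is differentiable at almost all points of the curve. A proof through the derivative of the
  curve would need differentiability of indefinite integrals almost everywhere. With gauge integrals
  the Henstock lemma replaces it: over a fine tagged division, the increments of \<open>p\<close> on the cells
  \<open>K\<close> with tags \<open>t\<close> differ from \<open>content K *\<^sub>R g t\<close> by a small sum, and the Lipschitz bound turns this
  into a small sum of errors for \<open>V\<close>. Setting the integrands to zero on \<open>N\<close> lets the same lemma
  control the cells with tags in \<open>N\<close>, where nothing is known about the derivative.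
\<close>

lemma chain_rule_absolutely_continuous:
  fixes p g :: "real \<Rightarrow> 'a::euclidean_space" and V :: "'a \<Rightarrow> 'b::euclidean_space"
  assumes ab: "a \<le> b"
    and g: "g absolutely_integrable_on {a..b}"
    and p: "\<And>t. t \<in> {a..b} \<Longrightarrow> p t = p a + integral {a..t} g"
    and lip: "L-lipschitz_on S V"
    and pS: "\<And>t. t \<in> {a..b} \<Longrightarrow> p t \<in> interior S"
    and N: "negligible N"
    and der: "\<And>t. t \<in> {a..b} - N \<Longrightarrow> (V has_derivative D t) (at (p t))"
  shows "((\<lambda>t. if t \<in> N then 0 else D t (g t)) has_integral V (p b) - V (p a)) {a..b}"
proof -
  have L0: "0 \<le> L" using lip by (rule lipschitz_on_nonneg)
  have pS': "p t \<in> S" if "t \<in> {a..b}" for t using pS[OF that] interior_subset by blast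
  have gint: "g integrable_on {a..b}" and ng: "(\<lambda>t. norm (g t)) integrable_on {a..b}"
    using g by (auto simp: absolutely_integrable_on_def)
  define k where "k t = (if t \<in> N then 0 else norm (g t))" for t
  have kint: "k integrable_on {a..b}"
    by (rule integrable_spike[OF ng N]) (simp add: k_def)
  have k_eq: "integral {u..v} k = integral {u..v} (\<lambda>t. norm (g t))" for u v
    by (rule integral_spike[OF N]) (simp add: k_def)
  \<comment> \<open>\<open>\<Phi>\<close> is the arc length; its increments bound those of the curve.\<close>
  define \<Phi> where "\<Phi> t = integral {a..t} k" for t
  have \<Phi>_diff: "integral {u..v} k = \<Phi> v - \<Phi> u" if "a \<le> u" "u \<le> v" "v \<le> b" for u v
    using Henstock_Kurzweil_Integration.integral_combine[of a u v k] that
      integrable_subinterval_real[OF kint, of a v] by (auto simp: \<Phi>_def)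
  have p_diff: "p v - p u = integral {u..v} g" if "a \<le> u" "u \<le> v" "v \<le> b" for u v
    using Henstock_Kurzweil_Integration.integral_combine[of a u v g] that
      integrable_subinterval_real[OF gint, of a v] p[of u] p[of v]
    by (auto simp: algebra_simps)
  have p_le: "norm (p v - p u) \<le> \<Phi> v - \<Phi> u" if "a \<le> u" "u \<le> v" "v \<le> b" for u v
  proof -
    have "norm (integral {u..v} g) \<le> integral {u..v} (\<lambda>t. norm (g t))"
      using that by (intro integral_norm_bound_integral integrable_subinterval_real[OF gint]
          integrable_subinterval_real[OF ng]) auto
    then show ?thesis using p_diff[OF that] \<Phi>_diff[OF that] k_eq by simp
  qed
  have \<Phi>b: "0 \<le> \<Phi> b"
    unfolding \<Phi>_def by (rule integral_nonneg[OF kint]) (simp add: k_def)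
  have pcont: "continuous_on {a..b} p"
  proof -
    have "continuous_on {a..b} (\<lambda>t. p a + integral {a..t} g)"
      by (intro continuous_intros indefinite_integral_continuous_1 gint)
    then show ?thesis by (rule continuous_on_eq) (rule p[symmetric])
  qed
  show ?thesis
    unfolding has_integral_real
  proof (intro allI impI)
    fix \<epsilon> :: real assume \<epsilon>: "\<epsilon> > 0"
    define e where "e = \<epsilon> / (\<Phi> b + 2 * L + 1)"
    have e: "e > 0" using \<epsilon> L0 \<Phi>b by (simp add: e_def)
    have e_eq: "e * (\<Phi> b + 2 * L + 1) = \<epsilon>" using L0 \<Phi>b by (simp add: e_def)
    obtain \<gamma>1 where \<gamma>1: "gauge \<gamma>1"
      "\<And>q. \<lbrakk>q tagged_partial_division_of (cbox a b); \<gamma>1 fine q\<rbrakk> \<Longrightarrow>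
             (\<Sum>(x,K)\<in>q. norm (content K *\<^sub>R g x - integral K g)) < e"
      using Henstock_lemma[of g a b e] gint e by (auto simp: box_real)
    obtain \<gamma>2 where \<gamma>2: "gauge \<gamma>2"
      "\<And>q. \<lbrakk>q tagged_partial_division_of (cbox a b); \<gamma>2 fine q\<rbrakk> \<Longrightarrow>
             (\<Sum>(x,K)\<in>q. norm (content K *\<^sub>R k x - integral K k)) < e"
      using Henstock_lemma[of k a b e] kint e by (auto simp: box_real)
    have "\<exists>d>0. t \<in> {a..b} - N \<longrightarrow> (\<forall>s\<in>{a..b}. \<bar>s - t\<bar> < d \<longrightarrow>
            norm (V (p s) - V (p t) - D t (p s - p t)) \<le> e * norm (p s - p t))" for t
    proof (cases "t \<in> {a..b} - N")
      case True
      obtain d1 where d1: "d1 > 0"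
        "\<And>q. norm (q - p t) < d1 \<Longrightarrow> norm (V q - V (p t) - D t (q - p t)) \<le> e * norm (q - p t)"
        using der[OF True] e unfolding has_derivative_at_alt by blast
      obtain d where d: "d > 0" "\<And>s. s \<in> {a..b} \<Longrightarrow> dist s t < d \<Longrightarrow> dist (p s) (p t) < d1"
        using pcont True d1(1) unfolding continuous_on_iff by (meson DiffD1)
      show ?thesis using d d1(2) by (intro exI[of _ d]) (auto simp: dist_norm)
    qed (auto intro!: exI[of _ 1])
    then obtain d where d: "\<And>t. d t > 0" "\<And>t s. \<lbrakk>t \<in> {a..b} - N; s \<in> {a..b}; \<bar>s - t\<bar> < d t\<rbrakk> \<Longrightarrow>
            norm (V (p s) - V (p t) - D t (p s - p t)) \<le> e * norm (p s - p t)"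
      by metis
    \<comment> \<open>The last gauge makes the linear approximation of \<open>V\<close> at the tag accurate on the whole cell.\<close>
    define \<gamma> where "\<gamma> t = (\<gamma>1 t \<inter> \<gamma>2 t) \<inter> ball t (d t)" for t
    show "\<exists>\<gamma>. gauge \<gamma> \<and> (\<forall>q. q tagged_division_of {a..b} \<and> \<gamma> fine q \<longrightarrow>
      norm ((\<Sum>(t,K)\<in>q. content K *\<^sub>R (if t \<in> N then 0 else D t (g t))) - (V (p b) - V (p a))) < \<epsilon>)"
    proof (intro exI conjI allI impI)
      show "gauge \<gamma>"
        unfolding \<gamma>_def using \<gamma>1(1) \<gamma>2(1) d(1) by (intro gauge_Int gauge_ball_dependent) auto
      fix q assume "q tagged_division_of {a..b} \<and> \<gamma> fine q"
      then have q: "q tagged_division_of {a..b}" and fine: "\<gamma>1 fine q" "\<gamma>2 fine q"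
        and fine_d: "(\<lambda>t. ball t (d t)) fine q"
        by (auto simp: \<gamma>_def fine_def)
      have qp: "q tagged_partial_division_of cbox a b"
        using q by (simp add: tagged_division_of_def box_real)
      define w where "w t = (if t \<in> N then 0 else D t (g t))" for t
      have term_le: "norm (content K *\<^sub>R w t - (V (p (Sup K)) - V (p (Inf K))))
          \<le> e * (\<Phi> (Sup K) - \<Phi> (Inf K)) + L * norm (content K *\<^sub>R g t - integral K g)
              + L * norm (content K *\<^sub>R k t - integral K k)"
        if tK: "(t, K) \<in> q" for t K
      proof -
        obtain u v where K: "K = {u..v}"
          using tagged_division_ofD(4)[OF q tK] by (auto simp: box_real)
        have tin: "t \<in> K" and Ksub: "K \<subseteq> {a..b}"
          using tagged_division_ofD(2,3)[OF q tK] by auto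
        have uv: "a \<le> u" "u \<le> t" "t \<le> v" "v \<le> b" using tin Ksub K by auto
        have SI: "Sup K = v" "Inf K = u" using uv by (auto simp: K)
        have cK: "content K = v - u" using uv by (simp add: K)
        have intK: "integral K k = \<Phi> v - \<Phi> u" "integral K g = p v - p u"
          using \<Phi>_diff p_diff uv by (auto simp: K)
        have mono: "\<Phi> u \<le> \<Phi> v" using p_le[of u v] norm_ge_zero[of "p v - p u"] uv by linarith
        show ?thesis
        proof (cases "t \<in> N")
          case True
          \<comment> \<open>Nothing is known about the derivative at the tag, but \<open>k t = 0\<close>: the arc length of the
            cell is then exactly the Henstock error of \<open>k\<close>.\<close>
          have "norm (V (p v) - V (p u)) \<le> L * norm (p v - p u)"
            using lipschitz_onD[OF lip pS' pS', of v u] uv by (simp add: dist_norm)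
          also have "\<dots> \<le> L * (\<Phi> v - \<Phi> u)"
            using p_le[of u v] uv L0 by (intro mult_left_mono) auto
          finally have "norm (V (p v) - V (p u)) \<le> L * norm (content K *\<^sub>R k t - integral K k)"
            using True mono by (simp add: k_def intK)
          moreover have "0 \<le> e * (\<Phi> v - \<Phi> u)" "0 \<le> L * norm (content K *\<^sub>R g t - integral K g)"
            using e mono L0 by auto
          ultimately show ?thesis using True unfolding w_def SI by (simp add: norm_minus_commute)
        next
          case False
          then have tN: "t \<in> {a..b} - N" using uv by auto
          interpret D: bounded_linear "D t"
            using der[OF tN] by (rule has_derivative_bounded_linear)
          have "v \<in> K" "u \<in> K" using uv by (auto simp: K)
          then have "v \<in> ball t (d t)" "u \<in> ball t (d t)"
            using fineD[OF fine_d tK] by blast+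
          then have near: "\<bar>v - t\<bar> < d t" "\<bar>u - t\<bar> < d t"
            by (auto simp: dist_real_def)
          have 1: "norm (V (p v) - V (p t) - D t (p v - p t)) \<le> e * (\<Phi> v - \<Phi> t)"
            using d(2)[OF tN _ near(1)] uv e p_le[of t v]
            by (smt (verit) atLeastAtMost_iff mult_le_cancel_left_pos)
          have 2: "norm (V (p u) - V (p t) - D t (p u - p t)) \<le> e * (\<Phi> t - \<Phi> u)"
            using d(2)[OF tN _ near(2)] uv e p_le[of u t] norm_minus_commute[of "p u" "p t"]
            by (smt (verit) atLeastAtMost_iff mult_le_cancel_left_pos)
          have 3: "norm (D t (content K *\<^sub>R g t - integral K g)) \<le> L * norm (content K *\<^sub>R g t - integral K g)"
            using lipschitz_derivative_bound[OF lip pS der[OF tN]] tN by auto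
          have "content K *\<^sub>R D t (g t) - (V (p v) - V (p u)) =
              D t (content K *\<^sub>R g t - integral K g) - (V (p v) - V (p t) - D t (p v - p t))
                + (V (p u) - V (p t) - D t (p u - p t))"
            unfolding intK by (simp add: D.diff D.scaleR D.add algebra_simps)
          also have "norm \<dots> \<le> L * norm (content K *\<^sub>R g t - integral K g) + e * (\<Phi> v - \<Phi> t) + e * (\<Phi> t - \<Phi> u)"
            by (rule order_trans[OF norm_triangle_ineq
                  add_mono[OF order_trans[OF norm_triangle_ineq4 add_mono[OF 3 1]] 2]])
          also have "\<dots> = e * (\<Phi> v - \<Phi> u) + L * norm (content K *\<^sub>R g t - integral K g)"
            by (simp add: algebra_simps)
          also have "\<dots> \<le> \<dots> + L * norm (content K *\<^sub>R k t - integral K k)"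
            using L0 by simp
          finally show ?thesis using False by (simp add: w_def SI)
        qed
      qed
      have "(\<Sum>(t,K)\<in>q. content K *\<^sub>R w t) - (V (p b) - V (p a)) =
          (\<Sum>(t,K)\<in>q. content K *\<^sub>R w t - (V (p (Sup K)) - V (p (Inf K))))"
        using additive_tagged_division_1[OF ab q, of "\<lambda>t. V (p t)"]
        by (simp add: sum_subtractf split_def)
      also have "norm \<dots> \<le> (\<Sum>(t,K)\<in>q. e * (\<Phi> (Sup K) - \<Phi> (Inf K))
              + L * norm (content K *\<^sub>R g t - integral K g)
              + L * norm (content K *\<^sub>R k t - integral K k))"
        by (rule sum_norm_le) (use term_le in auto)
      also have "\<dots> = e * (\<Sum>(t,K)\<in>q. \<Phi> (Sup K) - \<Phi> (Inf K))
          + L * (\<Sum>(t,K)\<in>q. norm (content K *\<^sub>R g t - integral K g))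
          + L * (\<Sum>(t,K)\<in>q. norm (content K *\<^sub>R k t - integral K k))"
        by (simp add: sum.distrib sum_distrib_left split_def)
      also have "(\<Sum>(t,K)\<in>q. \<Phi> (Sup K) - \<Phi> (Inf K)) = \<Phi> b"
        using additive_tagged_division_1[OF ab q, of \<Phi>] by (simp add: \<Phi>_def)
      also have "e * \<Phi> b + L * (\<Sum>(t,K)\<in>q. norm (content K *\<^sub>R g t - integral K g))
          + L * (\<Sum>(t,K)\<in>q. norm (content K *\<^sub>R k t - integral K k)) \<le> e * \<Phi> b + L * e + L * e"
        using \<gamma>1(2)[OF qp fine(1)] \<gamma>2(2)[OF qp fine(2)] L0 e
        by (intro add_mono mult_left_mono) auto
      also have "\<dots> < \<epsilon>" using e e_eq by (simp add: algebra_simps)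
      finally show "norm ((\<Sum>(t,K)\<in>q. content K *\<^sub>R (if t \<in> N then 0 else D t (g t)))
          - (V (p b) - V (p a))) < \<epsilon>"
        by (simp add: w_def)
    qed
  qed
qed

section \<open>Caratheodory right-hand sides\<close>

lemma caratheodory_obtain:
  fixes F :: "real \<times> (real ^ 'n::finite) \<Rightarrow> (real ^ 'n)"
  assumes "caratheodory F"
  obtains N m where "negligible N" "\<And>a b. m absolutely_integrable_on {a..b}"
    "\<And>t. t \<notin> N \<Longrightarrow> continuous_on UNIV (\<lambda>x. F (t, x))"
    "\<And>t x. t \<notin> N \<Longrightarrow> norm x \<le> r \<Longrightarrow> norm (F (t, x)) \<le> m t"
proof -
  obtain m :: "real \<Rightarrow> real" where m: "\<And>a b. m absolutely_integrable_on {a..b}"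
    "AE t in lebesgue. \<forall>x\<in>cball 0 r. norm (F (t, x)) \<le> m t"
    using assms unfolding caratheodory_def by meson
  have "AE t in lebesgue. continuous_on UNIV (\<lambda>x. F (t, x)) \<and> (\<forall>x\<in>cball 0 r. norm (F (t, x)) \<le> m t)"
    using assms m(2) unfolding caratheodory_def by (auto intro: AE_conjI)
  then obtain N where "N \<in> null_sets lebesgue"
    "{t. \<not> (continuous_on UNIV (\<lambda>x. F (t, x)) \<and> (\<forall>x\<in>cball 0 r. norm (F (t, x)) \<le> m t))} \<subseteq> N"
    unfolding eventually_ae_filter by auto
  then have "negligible N"
    "\<And>t. t \<notin> N \<Longrightarrow> continuous_on UNIV (\<lambda>x. F (t, x)) \<and> (\<forall>x\<in>cball 0 r. norm (F (t, x)) \<le> m t)"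
    by (auto simp only: negligible_iff_null_sets)
  then show ?thesis
    using that[of N m] m(1) by simp
qed

text \<open>
  Measurability is the point: \<open>y\<close> is the limit of the step functions \<open>y \<circ> s k\<close>, which take countably
  many values, so that \<open>F (t, y (s k t))\<close> is measurable piece by piece; continuity of \<open>F\<close> in the
  state carries this to the limit.
\<close>

lemma caratheodory_composition_integrable:
  fixes F :: "real \<times> (real ^ 'n::finite) \<Rightarrow> (real ^ 'n)"
  assumes F: "caratheodory F" and y: "continuous_on {a..b} y"
  shows "(\<lambda>t. F (t, y t)) absolutely_integrable_on {a..b}"
proof -
  have "bounded (y ` {a..b})"
    using compact_continuous_image[OF y compact_Icc] by (rule compact_imp_bounded)
  then obtain r where r: "\<And>t. t \<in> {a..b} \<Longrightarrow> norm (y t) \<le> r"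
    unfolding bounded_iff by blast
  obtain N m where N: "negligible N" and m: "\<And>a b. m absolutely_integrable_on {a..b}"
    and cont: "\<And>t. t \<notin> N \<Longrightarrow> continuous_on UNIV (\<lambda>x. F (t, x))"
    and le: "\<And>t x. t \<notin> N \<Longrightarrow> norm x \<le> r \<Longrightarrow> norm (F (t, x)) \<le> m t"
    using caratheodory_obtain[OF F, of r] by metis
  have NS [measurable]: "N \<in> sets lebesgue"
    using N by (simp add: negligible_iff_null_sets null_setsD2)
  have Fm [measurable]: "(\<lambda>t. F (t, x)) \<in> borel_measurable lebesgue" for x
    using F unfolding caratheodory_def by blast
  \<comment> \<open>Removing the exceptional times makes the pointwise properties hold everywhere.\<close>
  define G where "G t x = (if t \<in> N then 0 else F (t, x))" for t x
  \<comment> \<open>The largest multiple of \<open>1 / Suc k\<close> below \<open>t\<close>, cut off at \<open>a\<close> to stay where \<open>y\<close> is continuous.\<close>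
  define s where "s k t = max a (\<lfloor>real (Suc k) * t\<rfloor> / real (Suc k))" for k t
  have s_in: "s k t \<in> {a..b}" and s_le: "\<bar>s k t - t\<bar> \<le> 1 / real (Suc k)" if "t \<in> {a..b}" for k t
  proof -
    have "real_of_int \<lfloor>real (Suc k) * t\<rfloor> \<le> real (Suc k) * t"
      "real (Suc k) * t - 1 \<le> real_of_int \<lfloor>real (Suc k) * t\<rfloor>" by linarith+
    then have "real_of_int \<lfloor>real (Suc k) * t\<rfloor> / real (Suc k) \<le> real (Suc k) * t / real (Suc k)"
      "(real (Suc k) * t - 1) / real (Suc k) \<le> real_of_int \<lfloor>real (Suc k) * t\<rfloor> / real (Suc k)"
      by (intro divide_right_mono; simp)+
    then have "real_of_int \<lfloor>real (Suc k) * t\<rfloor> / real (Suc k) \<le> t"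
      "t - 1 / real (Suc k) \<le> real_of_int \<lfloor>real (Suc k) * t\<rfloor> / real (Suc k)"
      by (simp_all add: diff_divide_distrib del: of_nat_Suc)
    moreover have "0 \<le> 1 / real (Suc k)" by simp
    ultimately show "s k t \<in> {a..b}" "\<bar>s k t - t\<bar> \<le> 1 / real (Suc k)"
      using that unfolding s_def atLeastAtMost_iff by linarith+
  qed
  have s_lim: "(\<lambda>k. s k t) \<longlonglongrightarrow> t" if "t \<in> {a..b}" for t
  proof -
    have "(\<lambda>k. s k t - t) \<longlonglongrightarrow> 0"
      by (rule Lim_null_comparison[OF _ LIMSEQ_inverse_real_of_nat])
        (use s_le[OF that] in \<open>auto simp: inverse_eq_divide\<close>)
    then show ?thesis by (simp add: LIM_zero_iff)
  qed
  have "(\<lambda>t. G t (y t)) absolutely_integrable_on {a..b}"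
  proof (rule dominated_convergence_absolutely_integrable)
    show mi: "(\<lambda>t. \<bar>m t\<bar>) integrable_on {a..b}"
      using m[of a b] by (auto simp: absolutely_integrable_on_def)
    show "(\<lambda>t. G t (y (s k t))) absolutely_integrable_on {a..b}" for k
    proof (rule measurable_bounded_by_integrable_imp_absolutely_integrable[OF _ _ mi])
      have "(\<lambda>t. G t (y (max a (real_of_int \<lfloor>real (Suc k) * t\<rfloor> / real (Suc k))))) \<in> borel_measurable lebesgue"
      proof (rule measurable_compose_countable[where f="\<lambda>i t. G t (y (max a (real_of_int i / real (Suc k))))"])
        show "(\<lambda>t. G t (y (max a (real_of_int i / real (Suc k))))) \<in> borel_measurable lebesgue" for i
          unfolding G_def by measurable
        show "(\<lambda>t. \<lfloor>real (Suc k) * t\<rfloor>) \<in> lebesgue \<rightarrow>\<^sub>M count_space UNIV"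
          by (rule measurable_completion) measurable
      qed
      then show "(\<lambda>t. G t (y (s k t))) \<in> borel_measurable (lebesgue_on {a..b})"
        unfolding s_def by (rule measurable_restrict_space1)
      fix t assume "t \<in> {a..b}"
      then show "norm (G t (y (s k t))) \<le> \<bar>m t\<bar>"
        using le[of t "y (s k t)"] r[OF s_in] by (auto simp: G_def intro: order_trans)
    qed auto
    fix t assume t: "t \<in> {a..b}"
    show "norm (G t (y t)) \<le> \<bar>m t\<bar>"
      using le[of t "y t"] r[OF t] by (auto simp: G_def intro: order_trans)
    have "(\<lambda>k. y (s k t)) \<longlonglongrightarrow> y t"
      using continuous_on_tendsto_compose[OF y s_lim[OF t] t] s_in[OF t] by auto
    then show "(\<lambda>k. G t (y (s k t))) \<longlonglongrightarrow> G t (y t)"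
      unfolding G_def using continuous_on_tendsto_compose[OF cont] by auto
  qed
  then show ?thesis
    by (rule absolutely_integrable_spike[OF _ N]) (simp add: G_def)
qed

lemma caratheodory_composition_converges:
  fixes F :: "real \<times> (real ^ 'n::finite) \<Rightarrow> (real ^ 'n)"
  assumes F: "caratheodory F"
    and y: "continuous_on {a..b} y" and z: "\<And>k. continuous_on {a..b} (z k)"
    and bd: "\<And>t k. t \<in> {a..b} \<Longrightarrow> norm (z k t) \<le> r"
    and lim: "\<And>t. t \<in> {a..b} \<Longrightarrow> (\<lambda>k. z k t) \<longlonglongrightarrow> y t"
  shows "(\<lambda>k. integral {a..b} (\<lambda>t. norm (F (t, z k t) - F (t, y t)))) \<longlonglongrightarrow> 0"
proof -
  obtain N m where N: "negligible N" and m: "\<And>a b. m absolutely_integrable_on {a..b}"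
    and cont: "\<And>t. t \<notin> N \<Longrightarrow> continuous_on UNIV (\<lambda>x. F (t, x))"
    and le: "\<And>t x. t \<notin> N \<Longrightarrow> norm x \<le> r \<Longrightarrow> norm (F (t, x)) \<le> m t"
    using caratheodory_obtain[OF F, of r] by metis
  have yr: "norm (y t) \<le> r" if "t \<in> {a..b}" for t
    using bd[OF that] by (intro LIMSEQ_le_const2[OF tendsto_norm[OF lim[OF that]]]) auto
  have mi: "(\<lambda>t. m t + m t) integrable_on {a..b}"
    using m[of a b] by (intro integrable_add) (auto simp: absolutely_integrable_on_def)
  define d where "d k t = (if t \<in> N then 0 else norm (F (t, z k t) - F (t, y t)))" for k t
  define M where "M t = (if t \<in> N then 0 else m t + m t)" for t
  have "(\<lambda>k. integral {a..b} (d k)) \<longlonglongrightarrow> integral {a..b} (\<lambda>t. 0)"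
  proof (rule dominated_convergence)
    show "d k integrable_on {a..b}" for k
    proof (rule integrable_spike[OF _ N])
      show "(\<lambda>t. norm (F (t, z k t) - F (t, y t))) integrable_on {a..b}"
        using set_integral_diff(1)[OF caratheodory_composition_integrable[OF F z[of k]]
            caratheodory_composition_integrable[OF F y]]
        by (simp add: absolutely_integrable_on_def)
    qed (simp add: d_def)
    show "M integrable_on {a..b}"
      by (rule integrable_spike[OF mi N]) (simp add: M_def)
    fix t assume t: "t \<in> {a..b}"
    show "norm (d k t) \<le> M t" for k
      using le[of t "z k t"] le[of t "y t"] bd[OF t, of k] yr[OF t]
        norm_triangle_ineq4[of "F (t, z k t)" "F (t, y t)"] by (auto simp: d_def M_def)
    show "(\<lambda>k. d k t) \<longlonglongrightarrow> 0"
    proof (cases "t \<in> N")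
      case False
      have "(\<lambda>k. F (t, z k t)) \<longlonglongrightarrow> F (t, y t)"
        using continuous_on_tendsto_compose[OF cont[OF False] lim[OF t]] by auto
      then have "(\<lambda>k. norm (F (t, z k t) - F (t, y t))) \<longlonglongrightarrow> 0"
        by (simp add: LIM_zero tendsto_norm_zero)
      then show ?thesis using False by (simp add: d_def)
    qed (simp add: d_def)
  qed
  moreover have "integral {a..b} (d k) = integral {a..b} (\<lambda>t. norm (F (t, z k t) - F (t, y t)))" for k
    by (rule integral_spike[OF N]) (simp add: d_def)
  ultimately show ?thesis by simp
qed

section \<open>Solutions\<close>

lemma Icc_subset_solution_domain:
  assumes "solution F J t0 x0 x" "b \<in> J"
  shows "{t0..b} \<subseteq> J"
  using assms unfolding solution_def by (meson atLeastAtMost_iff is_interval_1 subsetI)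

lemma solution_continuous_on:
  assumes "solution F J t0 x0 x" "b \<in> J"
  shows "continuous_on {t0..b} x"
proof -
  have sub: "{t0..b} \<subseteq> J"
    using assms by (rule Icc_subset_solution_domain)
  have "(\<lambda>s. F (s, x s)) integrable_on {t0..b}"
    using assms unfolding solution_def absolutely_integrable_on_def by blast
  then have "continuous_on {t0..b} (\<lambda>t. x0 + integral {t0..t} (\<lambda>s. F (s, x s)))"
    by (intro continuous_intros indefinite_integral_continuous_1)
  then show ?thesis
    by (rule continuous_on_eq) (use assms sub in \<open>auto simp: solution_def\<close>)
qed

lemma solution_restart:
  assumes x: "solution F J t0 x0 x" and a: "a \<in> J"
  shows "solution F (J \<inter> {a..}) a (x a) x"
  unfolding solution_def
proof (intro conjI ballI)
  show "is_interval (J \<inter> {a..})"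
    using x by (auto simp: solution_def is_interval_Int is_interval_ci)
  show "a \<in> J \<inter> {a..}" "J \<inter> {a..} \<subseteq> {a..}" using a by auto
  fix t assume t: "t \<in> J \<inter> {a..}"
  have ta: "t0 \<le> a" "a \<le> t" using x a t by (auto simp: solution_def)
  have f: "(\<lambda>s. F (s, x s)) absolutely_integrable_on {t0..t}"
    using x t by (auto simp: solution_def)
  then show "(\<lambda>s. F (s, x s)) absolutely_integrable_on {a..t}"
    by (rule absolutely_integrable_on_subinterval) (use ta in auto)
  have "x t = x0 + integral {t0..t} (\<lambda>s. F (s, x s))" "x a = x0 + integral {t0..a} (\<lambda>s. F (s, x s))"
    using x t a by (auto simp: solution_def)
  moreover have "integral {t0..a} (\<lambda>s. F (s, x s)) + integral {a..t} (\<lambda>s. F (s, x s))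
      = integral {t0..t} (\<lambda>s. F (s, x s))"
    using f ta by (intro Henstock_Kurzweil_Integration.integral_combine)
      (auto simp: absolutely_integrable_on_def)
  ultimately show "x t = x a + integral {a..t} (\<lambda>s. F (s, x s))" by simp
qed

section \<open>Orbital derivatives along solutions\<close>

lemma locally_lipschitz_on_compact:
  assumes "locally_lipschitz f" "compact S"
  obtains L where "L-lipschitz_on S f"
proof -
  \<comment> \<open>The library notion concerns families of functions; \<open>f\<close> is a family with one parameter value.\<close>
  have "local_lipschitz {0::real} S (\<lambda>_. f)"
  proof (rule local_lipschitzI)
    fix t :: real and x assume "x \<in> S"
    obtain u L where "u > 0" "L-lipschitz_on (cball x u) f"
      using assms(1) unfolding locally_lipschitz_def by blast
    then show "\<exists>u>0. \<exists>L. \<forall>t\<in>cball t u \<inter> {0}. L-lipschitz_on (cball x u \<inter> S) f"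
      by (auto intro: lipschitz_on_subset)
  qed
  then obtain L where "\<And>t::real. t \<in> {0} \<Longrightarrow> L-lipschitz_on S f"
    by (rule local_lipschitz_compact_implies_lipschitz[OF _ assms(2) compact_sing[of "0::real"]])
      (rule continuous_on_const, blast)
  then show ?thesis using that by blast
qed

lemma locally_lipschitz_continuous_on:
  assumes "locally_lipschitz f"
  shows "continuous_on S f"
proof (rule continuous_at_imp_continuous_on, rule ballI)
  fix p
  obtain u L where "u > 0" "L-lipschitz_on (cball p u) f"
    using assms unfolding locally_lipschitz_def by blast
  then show "isCont f p"
    using lipschitz_on_continuous_on continuous_on_interior[of "cball p u" f p]
      interior_maximal[OF ball_subset_cball[of p u] open_ball] by force
qed

text \<open>
  A property that holds almost everywhere can fail on the whole graph of \<open>y\<close>, which is a null set.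
  It does hold almost everywhere on almost every translate: for fixed \<open>t\<close> the map \<open>h \<mapsto> y t + h\<close> preserves null
  sets, and Fubini's theorem exchanges the roles of \<open>t\<close> and \<open>h\<close>.
\<close>

lemma AE_translated_graph:
  fixes y :: "real \<Rightarrow> 'a::euclidean_space"
  assumes ae: "AE p in lebesgue. P p" and y [measurable]: "y \<in> borel_measurable borel"
  shows "AE h in lborel. AE t in lborel. P (t, y t + h)"
proof -
  have "AE p in lborel. P p" using ae by (simp add: AE_completion_iff)
  then obtain N where N: "N \<in> null_sets lborel" "{p. \<not> P p} \<subseteq> N"
    unfolding eventually_ae_filter by auto
  have Nm [measurable]: "N \<in> sets borel" using N(1) by (auto simp: null_sets_def)
  have "AE p in lborel. p \<notin> N" using N(1) by (rule AE_not_in)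
  then have "AE p in lborel \<Otimes>\<^sub>M (lborel :: 'a measure). p \<notin> N" unfolding lborel_prod .
  then have 1: "AE t in lborel. AE z in lborel. (t, z) \<notin> N" by (rule lborel_pair.AE_pair)
  have trans: "AE h in lborel. (t, y t + h) \<notin> N" if "AE z in lborel. (t, z) \<notin> N" for t
  proof -
    have "AE z in distr lborel borel ((+) (y t)). (t, z) \<notin> N"
      using that unfolding lborel_distr_plus .
    moreover have "{z \<in> space borel. (t, z) \<notin> N} \<in> sets borel" by measurable
    ultimately show ?thesis by (subst (asm) AE_distr_iff) auto
  qed
  have "AE t in lborel. AE h in lborel. (t, y t + h) \<notin> N"
    using 1 by eventually_elim (rule trans)
  moreover have shear [measurable]: "(\<lambda>x. (fst x, y (fst x) + snd x)) \<in> borel_measurable (borel :: (real \<times> 'a) measure)"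
    unfolding borel_prod[symmetric] by measurable
  then have "{x \<in> space (lborel \<Otimes>\<^sub>M (lborel :: 'a measure)). (fst x, y (fst x) + snd x) \<notin> N}
      \<in> sets (lborel \<Otimes>\<^sub>M lborel)"
    unfolding lborel_prod using measurable_sets[OF shear borel_comp[OF Nm]]
    by (simp add: vimage_def Collect_neg_eq)
  ultimately have "AE h in lborel. AE t in lborel. (t, y t + h) \<notin> N"
    using lborel_pair.AE_commute[of "\<lambda>t h. (t, y t + h) \<notin> N"] by blast
  then show ?thesis
  proof (rule eventually_mono)
    fix h assume "AE t in lborel. (t, y t + h) \<notin> N"
    then show "AE t in lborel. P (t, y t + h)"
      by (rule eventually_mono) (use N(2) in blast)
  qed
qed

lemma AE_lborel_arbitrarily_small:
  fixes P :: "'a::euclidean_space \<Rightarrow> bool"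
  assumes "AE h in lborel. P h" "e > 0"
  obtains h where "P h" "norm h < e"
proof -
  obtain N where N: "N \<in> null_sets lborel" "{h. \<not> P h} \<subseteq> N"
    using assms(1) unfolding eventually_ae_filter by auto
  have "negligible N"
    using N(1) by (simp add: negligible_iff_null_sets null_sets_completionI)
  moreover have "\<not> negligible (ball (0::'a) e)"
    using assms(2) by (intro open_not_negligible) auto
  ultimately obtain h where "h \<in> ball 0 e" "h \<notin> N"
    by (meson negligible_subset subsetI)
  then show ?thesis using that N(2) by auto
qed

text \<open>
  The differential inequality holds for almost all \<open>(t, x)\<close> only, and the solution may run inside the
  exceptional set. Almost every translate \<open>x + h\<close> avoids it, and along such a translate the chain rule
  applies. The translate is no solution: its velocity is \<open>F (t, x t)\<close> and not \<open>F (t, x t + h)\<close>. The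
  error in the orbital derivative is at most the Lipschitz constant times the difference, whose
  integral vanishes as \<open>h \<longlongrightarrow> 0\<close> because \<open>F\<close> is continuous in the state. The margin between \<open>r\<close> and
  \<open>R\<close> leaves room for the translation.
\<close>

lemma integral_inequality_along_solution:
  fixes F :: "real \<times> (real ^ 'n::finite) \<Rightarrow> (real ^ 'n)"
  assumes F: "caratheodory F" and sol: "solution F J t0 x0 x" and b: "b \<in> J"
    and small: "\<And>t. t \<in> {t0..b} \<Longrightarrow> norm (x t) \<le> r" and rR: "r < R"
    and V: "locally_lipschitz V" and U: "continuous_on UNIV U"
    and ae: "AE p in lebesgue. snd p \<in> cball 0 R \<longrightarrow>
               V differentiable (at p) \<and> orbital_derivative F V p \<le> U p"
  shows "V (b, x b) - V (t0, x t0) \<le> integral {t0..b} (\<lambda>s. U (s, x s))"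
proof -
  define f where "f s = F (s, x s)" for s
  have tb: "t0 \<le> b" using sol b by (auto simp: solution_def)
  have Jsub: "{t0..b} \<subseteq> J"
    using sol b by (rule Icc_subset_solution_domain)
  have fint: "f absolutely_integrable_on {t0..b}"
    using sol b unfolding solution_def f_def by blast
  have x_eq: "x t = x t0 + integral {t0..t} f" if "t \<in> {t0..b}" for t
    using sol that Jsub unfolding solution_def f_def by fastforce
  have xcont: "continuous_on {t0..b} x" using sol b by (rule solution_continuous_on)
  \<comment> \<open>One unit of time on either side puts the curve, end points included, into the interior.\<close>
  define K where "K = {t0 - 1..b + 1} \<times> cball (0 :: real ^ 'n) R"
  have "compact K" unfolding K_def by (intro compact_Times) auto
  then obtain L where L: "L-lipschitz_on K V" using locally_lipschitz_on_compact[OF V] by blast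
  have shifted_in_K: "(t, x t + h) \<in> interior K" if "t \<in> {t0..b}" "norm h < R - r" for t h
  proof -
    have "norm (x t + h) < R" using small[OF that(1)] that(2) norm_triangle_ineq[of "x t" h] by linarith
    then show ?thesis using that(1) unfolding K_def interior_Times by (auto simp: interior_cball)
  qed
  \<comment> \<open>A continuous extension to all times, as measurability requires.\<close>
  define x' where "x' t = x (max t0 (min b t))" for t
  have x'_eq: "x' t = x t" if "t \<in> {t0..b}" for t using that by (simp add: x'_def)
  have "continuous_on UNIV x'"
    unfolding x'_def using tb
    by (intro continuous_on_compose2[OF xcont] continuous_intros) auto
  then have "x' \<in> borel_measurable borel" by (rule borel_measurable_continuous_onI)
  from AE_translated_graph[OF ae this]
  have good: "AE h in lborel. AE t in lborel. x' t + h \<in> cball 0 R \<longrightarrow>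
      V differentiable (at (t, x' t + h)) \<and> orbital_derivative F V (t, x' t + h) \<le> U (t, x' t + h)"
    by simp
  have Ucont: "continuous_on {t0..b} (\<lambda>t. U (t, x t + h))" for h
    by (intro continuous_on_compose2[OF U] continuous_intros xcont) auto
  have shifted: "V (b, x b + h) - V (t0, x t0 + h) \<le>
      integral {t0..b} (\<lambda>t. U (t, x t + h)) + L * integral {t0..b} (\<lambda>t. norm (F (t, x t + h) - F (t, x t)))"
    if h: "norm h < R - r" and aeh: "AE t in lborel. x' t + h \<in> cball 0 R \<longrightarrow>
      V differentiable (at (t, x' t + h)) \<and> orbital_derivative F V (t, x' t + h) \<le> U (t, x' t + h)"
    for h
  proof -
    define good where "good t \<longleftrightarrow> (x' t + h \<in> cball 0 R \<longrightarrow>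
      V differentiable (at (t, x' t + h)) \<and> orbital_derivative F V (t, x' t + h) \<le> U (t, x' t + h))" for t
    have "AE t in lborel. good t" using aeh by (simp add: good_def)
    then obtain N where N0: "N \<in> null_sets lborel" "{t. \<not> good t} \<subseteq> N"
      unfolding eventually_ae_filter by auto
    have N: "negligible N"
      using N0(1) by (simp add: negligible_iff_null_sets null_sets_completionI)
    \<comment> \<open>The translated curve in space-time and its velocity.\<close>
    define p where "p t = (t, x t + h)" for t
    define g where "g t = (1::real, f t)" for t
    define D where "D t = frechet_derivative V (at (p t))" for t
    have pK: "p t \<in> interior K" if "t \<in> {t0..b}" for t
      unfolding p_def using shifted_in_K[OF that h] .
    have V_at: "V differentiable (at (p t))" "D t (1, F (p t)) \<le> U (p t)" if "t \<in> {t0..b} - N" for t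
    proof -
      have "good t" using that N0(2) by blast
      moreover have "p t \<in> K" using pK[of t] that interior_subset by blast
      ultimately show "V differentiable (at (p t))" "D t (1, F (p t)) \<le> U (p t)"
        using that by (auto simp: good_def x'_eq p_def K_def D_def orbital_derivative_def)
    qed
    have der: "(V has_derivative D t) (at (p t))" if "t \<in> {t0..b} - N" for t
      using V_at(1)[OF that] unfolding D_def by (simp add: frechet_derivative_works)
    have g_has: "(g has_integral (t - t0, integral {t0..t} f)) {t0..t}" if "t \<in> {t0..b}" for t
    proof -
      have "f integrable_on {t0..t}"
        using fint that by (auto simp: absolutely_integrable_on_def intro: integrable_subinterval_real)
      then have f: "(f has_integral integral {t0..t} f) {t0..t}" by (rule integrable_integral)
      have "((\<lambda>t. (1 :: real, 0 :: real ^ 'n)) has_integral (t - t0) *\<^sub>R (1, 0)) {t0..t}"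
        using has_integral_const_real[of "(1::real, 0 :: real ^ 'n)" t0 t] that by simp
      moreover have "((\<lambda>v. (0 :: real, v)) \<circ> f has_integral (0, integral {t0..t} f)) {t0..t}"
        by (rule has_integral_linear[OF f]) (intro bounded_linear_intros)
      ultimately have "((\<lambda>t. (1::real, 0::real ^ 'n) + ((\<lambda>v. (0::real, v)) \<circ> f) t) has_integral
          ((t - t0) *\<^sub>R (1::real, 0::real ^ 'n) + (0::real, integral {t0..t} f))) {t0..t}"
        by (rule has_integral_add)
      then show ?thesis by (simp add: g_def[abs_def])
    qed
    have g_abs: "g absolutely_integrable_on {t0..b}"
    proof (rule absolutely_integrable_integrable_bound)
      show "g integrable_on {t0..b}" using g_has[of b] tb by (auto simp: integrable_on_def)
      show "(\<lambda>t. 1 + norm (f t)) integrable_on {t0..b}"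
        using fint by (intro integrable_add) (auto simp: absolutely_integrable_on_def)
      show "norm (g t) \<le> 1 + norm (f t)" for t
        using norm_Pair_le[of "1::real" "f t"] by (simp add: g_def)
    qed
    have p_eq: "p t = p t0 + integral {t0..t} g" if "t \<in> {t0..b}" for t
      using x_eq[OF that] integral_unique[OF g_has[OF that]] by (simp add: p_def)
    have int: "((\<lambda>t. if t \<in> N then 0 else D t (g t)) has_integral V (p b) - V (p t0)) {t0..b}"
      by (rule chain_rule_absolutely_continuous[OF tb g_abs p_eq L pK N der])
    define u where "u t = U (p t) + L * norm (F (t, x t + h) - F (t, x t))" for t
    have nF: "(\<lambda>t. norm (F (t, x t + h) - F (t, x t))) integrable_on {t0..b}"
      using set_integral_diff(1)[OF caratheodory_composition_integrable[OF F]
          caratheodory_composition_integrable[OF F xcont]] xcont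
      by (simp add: absolutely_integrable_on_def continuous_intros)
    have u_int: "(u has_integral integral {t0..b} (\<lambda>t. U (p t))
        + L * integral {t0..b} (\<lambda>t. norm (F (t, x t + h) - F (t, x t)))) {t0..b}"
      unfolding u_def using Ucont[of h] nF
      by (intro has_integral_add has_integral_mult_right integrable_integral)
        (auto simp: p_def intro: integrable_continuous_real)
    have "V (p b) - V (p t0) \<le> integral {t0..b} (\<lambda>t. U (p t))
        + L * integral {t0..b} (\<lambda>t. norm (F (t, x t + h) - F (t, x t)))"
    proof (rule has_integral_le[OF int])
      show "((\<lambda>t. if t \<in> N then 0 else u t) has_integral integral {t0..b} (\<lambda>t. U (p t))
        + L * integral {t0..b} (\<lambda>t. norm (F (t, x t + h) - F (t, x t)))) {t0..b}"
        by (rule has_integral_spike[OF N _ u_int]) simp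
      fix t assume t: "t \<in> {t0..b}"
      show "(if t \<in> N then 0 else D t (g t)) \<le> (if t \<in> N then 0 else u t)"
      proof (cases "t \<in> N")
        case False
        then have tN: "t \<in> {t0..b} - N" using t by simp
        interpret D: bounded_linear "D t" using der[OF tN] by (rule has_derivative_bounded_linear)
        have "g t = (1, F (p t)) - (0, F (p t) - f t)" by (simp add: g_def)
        then have "D t (g t) = D t (1, F (p t)) - D t (0, F (p t) - f t)" by (simp only: D.diff)
        also have "\<dots> \<le> U (p t) + L * norm (F (p t) - f t)"
          using V_at(2)[OF tN] lipschitz_derivative_bound[OF L pK[OF t] der[OF tN], of "(0, F (p t) - f t)"]
          by (simp add: norm_Pair abs_le_iff)
        finally show ?thesis using False by (simp add: u_def p_def f_def)
      qed simp
    qed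
    then show ?thesis by (simp add: p_def)
  qed
  define admissible where "admissible h \<longleftrightarrow> (AE t in lborel. x' t + h \<in> cball 0 R \<longrightarrow>
      V differentiable (at (t, x' t + h)) \<and> orbital_derivative F V (t, x' t + h) \<le> U (t, x' t + h))" for h
  have "AE h in lborel. admissible h" using good by (simp add: admissible_def)
  then have "\<exists>h. norm h < min (R - r) (1 / real (Suc k)) \<and> admissible h" for k
    using AE_lborel_arbitrarily_small[of admissible "min (R - r) (1 / real (Suc k))"] rR by auto
  then obtain h where h: "\<And>k. norm (h k) < min (R - r) (1 / real (Suc k))" "\<And>k. admissible (h k)"
    by metis
  have "norm (h k) \<le> inverse (real (Suc k))" for k
    using h(1)[of k] by (simp add: inverse_eq_divide)
  then have h_lim: "h \<longlonglongrightarrow> 0"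
    by (intro Lim_null_comparison[OF _ LIMSEQ_inverse_real_of_nat] always_eventually allI)
  have xh_lim: "(\<lambda>k. x t + h k) \<longlonglongrightarrow> x t" for t
    using tendsto_add[OF tendsto_const[of "x t"] h_lim] by simp
  have Vlim: "(\<lambda>k. V (t, x t + h k)) \<longlonglongrightarrow> V (t, x t)" for t
    using continuous_on_tendsto_compose[OF locally_lipschitz_continuous_on[OF V, of UNIV]
        tendsto_Pair[OF tendsto_const[of t] xh_lim[of t]]] by auto
  have xh_in: "(t, x t + h k) \<in> K" if "t \<in> {t0..b}" for t k
    using shifted_in_K[OF that, of "h k"] h(1)[of k] interior_subset by auto
  have Ulim: "(\<lambda>k. integral {t0..b} (\<lambda>t. U (t, x t + h k))) \<longlonglongrightarrow> integral {t0..b} (\<lambda>t. U (t, x t))"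
  proof -
    have "bounded (U ` K)"
      using \<open>compact K\<close> U by (meson compact_continuous_image compact_imp_bounded continuous_on_subset subset_UNIV)
    then obtain B where B: "\<And>q. q \<in> K \<Longrightarrow> norm (U q) \<le> B"
      unfolding bounded_iff by blast
    show ?thesis
    proof (rule dominated_convergence(2)[where h="\<lambda>_. B"])
      show "(\<lambda>t. U (t, x t + h k)) integrable_on {t0..b}" for k
        using Ucont by (rule integrable_continuous_real)
      show "norm (U (t, x t + h k)) \<le> B" if "t \<in> {t0..b}" for k t
        using B xh_in[OF that] by blast
      show "(\<lambda>k. U (t, x t + h k)) \<longlonglongrightarrow> U (t, x t)" for t
        using continuous_on_tendsto_compose[OF U tendsto_Pair[OF tendsto_const[of t] xh_lim[of t]]] by auto
    qed auto
  qed
  have Flim: "(\<lambda>k. integral {t0..b} (\<lambda>t. norm (F (t, x t + h k) - F (t, x t)))) \<longlonglongrightarrow> 0"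
    by (rule caratheodory_composition_converges[OF F xcont, where r=R])
      (use xh_in xh_lim in \<open>auto simp: K_def intro!: continuous_intros xcont\<close>)
  have "V (b, x b) - V (t0, x t0) \<le> integral {t0..b} (\<lambda>s. U (s, x s)) + L * 0"
    by (rule LIMSEQ_le[OF tendsto_diff[OF Vlim Vlim] tendsto_add[OF Ulim tendsto_mult[OF tendsto_const Flim]]])
      (use shifted h in \<open>auto simp: admissible_def\<close>)
  then show ?thesis by simp
qed

section \<open>Nested nonpositive functions and time averages\<close>

text \<open>
  On the compact part of \<open>D\<close> where \<open>g \<ge> \<eta>\<close> the function \<open>h\<close> cannot vanish, hence it is bounded away
  from zero there and a large multiple of it outweighs \<open>g\<close>; elsewhere adding \<open>h\<close> does no harm.
\<close>

lemma nested_penalty_step: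
  fixes g h :: "'a::t2_space \<Rightarrow> real"
  assumes D: "compact D" and g: "continuous_on D g" and h: "continuous_on D h"
    and nonpos: "\<And>q. q \<in> D \<Longrightarrow> h q \<le> 0"
    and zero: "\<And>q. q \<in> D \<Longrightarrow> h q = 0 \<Longrightarrow> g q < \<eta>"
  obtains c where "c \<ge> 0" "\<And>q. q \<in> D \<Longrightarrow> g q + c * h q < \<eta>"
proof -
  define E where "E = D \<inter> g -` {\<eta>..}"
  have "closed E"
    unfolding E_def by (intro continuous_closed_preimage[OF g compact_imp_closed[OF D]] closed_atLeast)
  then have E: "compact E"
    using compact_Int_closed[OF D] by (metis E_def inf.absorb_iff2 inf_le1)
  have ED: "E \<subseteq> D" by (auto simp: E_def)
  show ?thesis
  proof (cases "E = {}")
    case True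
    then show ?thesis using that[of 0] by (force simp: E_def)
  next
    case False
    obtain p where p: "p \<in> E" "\<And>q. q \<in> E \<Longrightarrow> h q \<le> h p"
      using continuous_attains_sup[OF E False continuous_on_subset[OF h ED]] by blast
    obtain p' where p': "p' \<in> E" "\<And>q. q \<in> E \<Longrightarrow> g q \<le> g p'"
      using continuous_attains_sup[OF E False continuous_on_subset[OF g ED]] by blast
    have hp: "h p < 0"
      using p(1) nonpos[of p] zero[of p] by (force simp: E_def)
    have gp': "g p' \<ge> \<eta>" using p'(1) by (simp add: E_def)
    define c where "c = (g p' - \<eta> + 1) / (- h p)"
    have c0: "c \<ge> 0" using hp gp' by (simp add: c_def divide_nonneg_neg)
    have chp: "c * h p = \<eta> - g p' - 1" using hp by (simp add: c_def field_simps)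
    have "g q + c * h q < \<eta>" if q: "q \<in> D" for q
    proof (cases "q \<in> E")
      case True
      have "c * h q \<le> c * h p" using p(2)[OF True] c0 by (rule mult_left_mono)
      then show ?thesis using p'(2)[OF True] chp by linarith
    next
      case False
      then have "g q < \<eta>" using q by (auto simp: E_def)
      then show ?thesis using mult_nonneg_nonpos[OF c0 nonpos[OF q]] by linarith
    qed
    then show ?thesis using that c0 by blast
  qed
qed

text \<open>
  The compactness argument behind Matrosov's theorem. The weights are chosen from the last function
  to the first: on the set where all earlier ones vanish, the next one is nonpositive and the
  penalty step applies to what has been accumulated so far.
\<close>

lemma nested_penalty:
  fixes g :: "'a::t2_space \<Rightarrow> real" and Y :: "nat \<Rightarrow> 'a \<Rightarrow> real"
  assumes D: "compact D"
    and "continuous_on D g"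
    and "\<And>i. i \<in> {1..j} \<Longrightarrow> continuous_on D (Y i)"
    and "\<And>k q. \<lbrakk>k \<in> {1..j}; q \<in> D; \<forall>i\<in>{1..<k}. Y i q = 0\<rbrakk> \<Longrightarrow> Y k q \<le> 0"
    and "\<And>q. \<lbrakk>q \<in> D; \<forall>i\<in>{1..j}. Y i q = 0\<rbrakk> \<Longrightarrow> g q < \<eta>"
  shows "\<exists>c. (\<forall>i. c i \<ge> 0) \<and> (\<forall>q\<in>D. g q + (\<Sum>i\<in>{1..j}. c i * Y i q) < \<eta>)"
  using assms(2-)
proof (induction j arbitrary: g)
  case 0
  then show ?case by (intro exI[of _ "\<lambda>_. 0"]) auto
next
  case (Suc j)
  define Z where "Z = D \<inter> (\<Inter>i\<in>{1..j}. D \<inter> Y i -` {0})"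
  have Z_iff: "q \<in> Z \<longleftrightarrow> q \<in> D \<and> (\<forall>i\<in>{1..j}. Y i q = 0)" for q by (auto simp: Z_def)
  have Z: "compact Z"
    unfolding Z_def
    by (intro compact_Int_closed[OF D] closed_INT ballI
        continuous_closed_preimage[OF Suc.prems(2) compact_imp_closed[OF D]]) auto
  have ZD: "Z \<subseteq> D" by (auto simp: Z_def)
  obtain c where c: "c \<ge> 0" "\<And>q. q \<in> Z \<Longrightarrow> g q + c * Y (Suc j) q < \<eta>"
  proof (rule nested_penalty_step[OF Z])
    show "continuous_on Z g" "continuous_on Z (Y (Suc j))"
      using Suc.prems(1,2) ZD by (auto intro: continuous_on_subset)
    show "Y (Suc j) q \<le> 0" if "q \<in> Z" for q
      using Suc.prems(3)[of "Suc j" q] that by (auto simp: Z_iff)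
    show "g q < \<eta>" if "q \<in> Z" "Y (Suc j) q = 0" for q
    proof (rule Suc.prems(4))
      show "\<forall>i\<in>{1..Suc j}. Y i q = 0"
        using that by (auto simp: Z_iff le_Suc_eq)
    qed (use that in \<open>auto simp: Z_iff\<close>)
  qed blast
  have "\<exists>d. (\<forall>i. d i \<ge> 0) \<and> (\<forall>q\<in>D. (g q + c * Y (Suc j) q) + (\<Sum>i\<in>{1..j}. d i * Y i q) < \<eta>)"
  proof (rule Suc.IH)
    show "continuous_on D (\<lambda>q. g q + c * Y (Suc j) q)"
      using Suc.prems(1,2) by (intro continuous_intros) auto
  qed (use Suc.prems c Z_iff in auto)
  then obtain d where d: "\<And>i. d i \<ge> 0"
    "\<And>q. q \<in> D \<Longrightarrow> (g q + c * Y (Suc j) q) + (\<Sum>i\<in>{1..j}. d i * Y i q) < \<eta>" by blast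
  have "(\<Sum>i\<in>{1..j}. (d(Suc j := c)) i * Y i q) = (\<Sum>i\<in>{1..j}. d i * Y i q)" for q
    by (rule sum.cong) auto
  then show ?case
    using d c(1) by (intro exI[of _ "d(Suc j := c)"]) (auto simp: algebra_simps)
qed

text \<open>
  A violation of the bound at one point would persist, by continuity, on a nonempty open set, which is
  not a null set.
\<close>

lemma AE_bound_imp_bound_on_ball:
  fixes f :: "real \<times> 'a::euclidean_space \<Rightarrow> real"
  assumes ae: "AE p in lebesgue. snd p \<in> cball 0 R \<longrightarrow> f p \<le> c"
    and f: "continuous_on UNIV f" and x: "norm x < R"
  shows "f (t, x) \<le> c"
proof (rule ccontr)
  assume gt: "\<not> f (t, x) \<le> c"
  define S where "S = f -` {c<..} \<inter> (UNIV \<times> ball 0 R)"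
  have "open S"
    unfolding S_def by (intro open_Int open_Times open_vimage[OF _ f]) auto
  moreover have "(t, x) \<in> S" using gt x by (simp add: S_def)
  ultimately have "\<not> negligible S" using open_not_negligible by blast
  moreover obtain N where "N \<in> null_sets lebesgue" "{p. \<not> (snd p \<in> cball 0 R \<longrightarrow> f p \<le> c)} \<subseteq> N"
    using ae unfolding eventually_ae_filter by auto
  then have "negligible S"
    by (auto simp: negligible_iff_null_sets[symmetric] S_def intro!: negligible_subset[of N])
  ultimately show False by blast
qed

text \<open>
  The time average of \<open>g\<close> along the solution is at most \<open>\<eta>\<close> up to a constant that does not depend on
  the length of the interval: the weighted sum of the \<open>Y i\<close> integrates to at least the weighted sum of
  the increments of the \<open>V i\<close>, and these are bounded.
\<close>

lemma integral_dissipation_bound: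
  fixes F :: "real \<times> (real ^ 'n::finite) \<Rightarrow> (real ^ 'n)"
    and \<phi> :: "real \<times> (real ^ 'n) \<Rightarrow> (real ^ 'm::finite)"
  assumes F: "caratheodory F" and sol: "solution F J t0 x0 x" and b: "b \<in> J"
    and small: "\<And>t. t \<in> {t0..b} \<Longrightarrow> norm (x t) \<le> r" and rR: "r < R"
    and V: "\<And>i. i \<in> A \<Longrightarrow> locally_lipschitz (V i)"
    and \<phi>: "continuous_on UNIV \<phi>"
    and Y: "\<And>i. i \<in> A \<Longrightarrow> continuous_on UNIV (Y i)"
    and ae: "\<And>i. i \<in> A \<Longrightarrow> AE p in lebesgue. snd p \<in> cball 0 R \<longrightarrow>
               V i differentiable (at p) \<and> orbital_derivative F (V i) p \<le> Y i (snd p, \<phi> p)"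
    and V_le: "\<And>i t z. i \<in> A \<Longrightarrow> norm z \<le> r \<Longrightarrow> \<bar>V i (t, z)\<bar> \<le> \<mu>"
    and \<phi>_le: "\<And>t z. norm z \<le> r \<Longrightarrow> norm (\<phi> (t, z)) \<le> \<mu>"
    and g: "continuous_on UNIV g"
    and c: "\<And>i. c i \<ge> 0"
    and pen: "\<And>z \<psi>. norm z \<le> r \<Longrightarrow> norm \<psi> \<le> \<mu> \<Longrightarrow> g (z, \<psi>) + (\<Sum>i\<in>A. c i * Y i (z, \<psi>)) \<le> \<eta>"
  shows "integral {t0..b} (\<lambda>s. g (x s, \<phi> (s, x s))) \<le> \<eta> * (b - t0) + 2 * \<mu> * (\<Sum>i\<in>A. c i)"
proof -
  have tb: "t0 \<le> b" using sol b by (auto simp: solution_def)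
  have xcont: "continuous_on {t0..b} x" using sol b by (rule solution_continuous_on)
  have comp: "continuous_on {t0..b} (\<lambda>s. k (x s, \<phi> (s, x s)))" if "continuous_on UNIV k"
    for k :: "_ \<Rightarrow> real"
    by (intro continuous_on_compose2[OF that] continuous_on_compose2[OF \<phi>] continuous_intros xcont) auto
  define y where "y i = integral {t0..b} (\<lambda>s. Y i (x s, \<phi> (s, x s)))" for i
  have y_ge: "- 2 * \<mu> \<le> y i" if i: "i \<in> A" for i
  proof -
    have "V i (b, x b) - V i (t0, x t0) \<le> integral {t0..b} (\<lambda>s. Y i (snd (s, x s), \<phi> (s, x s)))"
      using integral_inequality_along_solution[OF F sol b small rR V[OF i], of "\<lambda>p. Y i (snd p, \<phi> p)"] ae[OF i]
      by (simp add: continuous_on_compose2[OF Y[OF i]] continuous_intros \<phi>)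
    moreover have "\<bar>V i (b, x b)\<bar> \<le> \<mu>" "\<bar>V i (t0, x t0)\<bar> \<le> \<mu>"
      using V_le[OF i] small tb by auto
    ultimately show ?thesis by (simp add: y_def)
  qed
  have gi: "(\<lambda>s. g (x s, \<phi> (s, x s))) integrable_on {t0..b}"
    by (intro integrable_continuous_real comp g)
  have Yi: "(\<lambda>s. c i * Y i (x s, \<phi> (s, x s))) integrable_on {t0..b}" if "i \<in> A" for i
    by (intro integrable_continuous_real continuous_on_mult_left comp Y that)
  have "integral {t0..b} (\<lambda>s. g (x s, \<phi> (s, x s))) \<le>
      integral {t0..b} (\<lambda>s. \<eta> - (\<Sum>i\<in>A. c i * Y i (x s, \<phi> (s, x s))))"
  proof (rule integral_le[OF gi])
    show "(\<lambda>s. \<eta> - (\<Sum>i\<in>A. c i * Y i (x s, \<phi> (s, x s)))) integrable_on {t0..b}"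
      by (intro integrable_continuous_real continuous_intros comp Y)
    show "g (x s, \<phi> (s, x s)) \<le> \<eta> - (\<Sum>i\<in>A. c i * Y i (x s, \<phi> (s, x s)))" if "s \<in> {t0..b}" for s
      using pen[OF small[OF that] \<phi>_le[OF small[OF that], of s]] by linarith
  qed
  also have "\<dots> = \<eta> * (b - t0) - integral {t0..b} (\<lambda>s. \<Sum>i\<in>A. c i * Y i (x s, \<phi> (s, x s)))"
    using tb by (subst integral_diff)
      (auto intro!: integrable_continuous_real continuous_intros comp Y)
  also have "integral {t0..b} (\<lambda>s. \<Sum>i\<in>A. c i * Y i (x s, \<phi> (s, x s))) = (\<Sum>i\<in>A. c i * y i)"
  proof (cases "finite A")
    case True
    then show ?thesis using Yi by (simp add: integral_sum y_def)
  qed simp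
  also have "(\<Sum>i\<in>A. c i * (- 2 * \<mu>)) \<le> (\<Sum>i\<in>A. c i * y i)"
    using y_ge c by (intro sum_mono mult_left_mono) auto
  then have "\<eta> * (b - t0) - (\<Sum>i\<in>A. c i * y i) \<le> \<eta> * (b - t0) + 2 * \<mu> * (\<Sum>i\<in>A. c i)"
    unfolding sum_distrib_right[symmetric] by (simp add: mult_ac)
  finally show ?thesis .
qed

lemma exists_window_small_integral:
  fixes f :: "real \<Rightarrow> real"
  assumes f: "f integrable_on {a..a + real n * l}" and l: "l > 0" and n: "n > 0"
    and le: "integral {a..a + real n * l} f \<le> e * (real n * l)"
  obtains s where "a \<le> s" "s + l \<le> a + real n * l" "integral {s..s + l} f \<le> e * l"
proof -
  define w where "w k = integral {a + real k * l..a + real k * l + l} f" for k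
  have split: "integral {a..a + real k * l} f = (\<Sum>i<k. w i)" if "k \<le> n" for k
    using that
  proof (induction k)
    case (Suc k)
    have "f integrable_on {a..a + real (Suc k) * l}"
      by (rule integrable_subinterval_real[OF f]) (use Suc.prems l in \<open>auto intro!: mult_right_mono\<close>)
    then have "integral {a..a + real k * l} f + integral {a + real k * l..a + real (Suc k) * l} f
        = integral {a..a + real (Suc k) * l} f"
      using l by (intro Henstock_Kurzweil_Integration.integral_combine) (auto intro!: mult_right_mono)
    then show ?case using Suc by (simp add: w_def algebra_simps)
  qed simp
  have "\<exists>k<n. w k \<le> e * l"
  proof (rule ccontr)
    assume "\<not> ?thesis"
    then have "(\<Sum>i<n. e * l) < (\<Sum>i<n. w i)" using n by (intro sum_strict_mono) auto
    then show False using le split[of n] by (simp add: mult_ac)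
  qed
  then obtain k where k: "k < n" "w k \<le> e * l" by blast
  have "real (Suc k) * l \<le> real n * l" using k(1) l by (intro mult_right_mono) auto
  then show ?thesis
    using k(2) l by (intro that[of "a + real k * l"]) (auto simp: w_def algebra_simps)
qed

section \<open>Persistency of excitation\<close>

lemma bounded_linear_block: "bounded_linear (block (I :: 'n::finite set))"
  unfolding linear_conv_bounded_linear[symmetric]
  by (rule linearI) (auto simp: block_def vec_eq_iff)

lemma continuous_on_block [continuous_intros]:
  "continuous_on S f \<Longrightarrow> continuous_on S (\<lambda>x. block (I :: 'n::finite set) (f x))"
  by (rule bounded_linear.continuous_on[OF bounded_linear_block])

lemma block_add_block_Compl: "block I x + block (- I) x = x"
  by (simp add: block_def vec_eq_iff)

lemma block_block: "block I (block J x) = block (I \<inter> J) x"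
  by (simp add: block_def vec_eq_iff)

lemma block_empty: "block {} x = 0"
  by (simp add: block_def vec_eq_iff)

lemma norm_block_le: "norm (block I (x :: real ^ 'n::finite)) \<le> norm x"
  unfolding norm_vec_def by (rule L2_set_mono) (auto simp: block_def)

text \<open>
  Excitation and the Lipschitz bound are local statements around each point; a finite cover makes the
  constants uniform. The balls of the cover have half the admissible radius, so that every point of
  \<open>C\<close> keeps a neighbourhood of its own. The excitation times can be enlarged to a common one because
  the integrand is nonnegative.
\<close>

lemma uniform_excitation_on_compact:
  fixes G :: "real \<times> (real ^ 'n::finite) \<Rightarrow> 'b::euclidean_space"
  assumes pe: "u_delta_PE I2 G" and lip: "locally_lipschitz_uniformly G"
    and C: "compact C" and nz: "\<And>x. x \<in> C \<Longrightarrow> block I2 x \<noteq> 0"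
  obtains T \<mu> r L where "T > 0" "\<mu> > 0" "r > 0" "L \<ge> 0"
    "\<And>t x. x \<in> C \<Longrightarrow> \<mu> \<le> integral {t..t + T} (\<lambda>\<tau>. norm (G (\<tau>, x)))"
    "\<And>t x y. \<lbrakk>x \<in> C; norm (y - x) \<le> r\<rbrakk> \<Longrightarrow> norm (G (t, y) - G (t, x)) \<le> L * norm (y - x)"
proof -
  have "\<exists>d T \<mu> L. d > 0 \<and> (x \<in> C \<longrightarrow> T > 0 \<and> \<mu> > 0 \<and>
      (\<forall>t z. norm (z - x) \<le> 2 * d \<longrightarrow> \<mu> \<le> integral {t..t + T} (\<lambda>\<tau>. norm (G (\<tau>, z)))) \<and>
      (\<forall>t. L-lipschitz_on (cball x (2 * d)) (\<lambda>z. G (t, z))))" for x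
  proof (cases "x \<in> C")
    case True
    obtain d1 T \<mu> where 1: "d1 > 0" "T > 0" "\<mu> > 0"
      "\<And>t z. norm (z - x) \<le> d1 \<Longrightarrow> \<mu> \<le> integral {t..t + T} (\<lambda>\<tau>. norm (G (\<tau>, z)))"
      using pe nz[OF True] unfolding u_delta_PE_def by blast
    obtain u L where 2: "u > 0" "\<And>t. L-lipschitz_on (cball x u) (\<lambda>z. G (t, z))"
      using lip unfolding locally_lipschitz_uniformly_def by blast
    have "\<forall>t. L-lipschitz_on (cball x (2 * (min d1 u / 2))) (\<lambda>z. G (t, z))"
      by (intro allI lipschitz_on_subset[OF 2(2)]) auto
    then show ?thesis
      using 1 2(1) by (intro exI[of _ "min d1 u / 2"] exI[of _ T] exI[of _ \<mu>] exI[of _ L]) auto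
  qed (auto intro: exI[of _ 1])
  then obtain d T \<mu> L where dpos: "\<And>x. d x > 0" and
    H: "\<And>x. x \<in> C \<Longrightarrow> T x > 0" "\<And>x. x \<in> C \<Longrightarrow> \<mu> x > 0"
      "\<And>x t z. \<lbrakk>x \<in> C; norm (z - x) \<le> 2 * d x\<rbrakk> \<Longrightarrow> \<mu> x \<le> integral {t..t + T x} (\<lambda>\<tau>. norm (G (\<tau>, z)))"
      "\<And>x t. x \<in> C \<Longrightarrow> (L x)-lipschitz_on (cball x (2 * d x)) (\<lambda>z. G (t, z))"
    by metis
  obtain P where P: "P \<subseteq> C" "finite P" "C \<subseteq> (\<Union>x\<in>P. ball x (d x))"
    by (rule compactE_image[OF C, of C "\<lambda>x. ball x (d x)"]) (use dpos in auto)
  define T0 where "T0 = Max (insert 1 (T ` P))"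
  define \<mu>0 where "\<mu>0 = Min (insert 1 (\<mu> ` P))"
  define r0 where "r0 = Min (insert 1 (d ` P))"
  define L0 where "L0 = Max (insert 0 (L ` P))"
  have pos: "T0 > 0" "\<mu>0 > 0" "r0 > 0" "L0 \<ge> 0"
    unfolding T0_def \<mu>0_def r0_def L0_def using P(1,2) H(2) dpos
    by (auto simp: Min_gr_iff Max_gr_iff intro!: Max_ge)
  have bounds: "T p \<le> T0" "\<mu>0 \<le> \<mu> p" "r0 \<le> d p" "L p \<le> L0" if "p \<in> P" for p
    unfolding T0_def \<mu>0_def r0_def L0_def using P(2) that by (auto intro!: Max_ge Min_le)
  show ?thesis
  proof (rule that[OF pos])
    fix t x assume "x \<in> C"
    then obtain p where p: "p \<in> P" "norm (x - p) < d p"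
      using P(3) by (auto simp: dist_norm norm_minus_commute)
    have G_int: "(\<lambda>\<tau>. norm (G (\<tau>, x))) integrable_on {a..b}" for a b
      using pe unfolding u_delta_PE_def absolutely_integrable_on_def by blast
    have "\<mu>0 \<le> \<mu> p" using bounds p(1) by blast
    also have "\<dots> \<le> integral {t..t + T p} (\<lambda>\<tau>. norm (G (\<tau>, x)))"
      using H(3)[of p x t] p P(1) dpos[of p] by auto
    also have "\<dots> \<le> integral {t..t + T0} (\<lambda>\<tau>. norm (G (\<tau>, x)))"
      using bounds(1)[OF p(1)] by (intro integral_subset_le G_int) auto
    finally show "\<mu>0 \<le> integral {t..t + T0} (\<lambda>\<tau>. norm (G (\<tau>, x)))" .
  next
    fix t x y assume "x \<in> C" and y: "norm (y - x) \<le> r0"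
    then obtain p where p: "p \<in> P" "norm (x - p) < d p"
      using P(3) by (auto simp: dist_norm norm_minus_commute)
    have "norm (y - p) \<le> 2 * d p"
      using norm_triangle_ineq[of "y - x" "x - p"] y p bounds(3)[OF p(1)] by simp
    then have "y \<in> cball p (2 * d p)" "x \<in> cball p (2 * d p)"
      using p dpos[of p] by (auto simp: dist_norm norm_minus_commute)
    then have "norm (G (t, y) - G (t, x)) \<le> L p * norm (y - x)"
      using lipschitz_onD[OF H(4)[of p t]] p(1) P(1) by (auto simp: dist_norm)
    also have "\<dots> \<le> L0 * norm (y - x)"
      using bounds(4)[OF p(1)] by (intro mult_right_mono) auto
    finally show "norm (G (t, y) - G (t, x)) \<le> L0 * norm (y - x)" .
  qed
qed

text \<open>
  Here \<open>q\<close> dominates the first block of the state, the excitation signal and the speed of the second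
  block. If its average over an interval of length \<open>l\<close> is at most \<open>e\<close>, then the second block moves by at
  most \<open>e * l\<close>, so the signal along the solution is close to the signal at the frozen point
  \<open>z = col[0, x\<^sub>2 t0]\<close>. The latter has integral at least \<open>\<mu>\<close> unless \<open>z\<close> is small. As the first block is
  small at some instant, a small \<open>z\<close> means that the whole state is small at that instant.
\<close>

lemma excited_solution_visits_ball:
  fixes F :: "real \<times> (real ^ 'n::finite) \<Rightarrow> (real ^ 'n)"
    and G :: "real \<times> (real ^ 'n) \<Rightarrow> 'b::euclidean_space"
  assumes sol: "solution F J t0 x0 x" and J: "t0 + l \<in> J" and l: "l > 0"
    and x_le: "\<And>t. t \<in> {t0..t0 + l} \<Longrightarrow> norm (x t) \<le> r"
    and q: "continuous_on {t0..t0 + l} q" and q_le: "integral {t0..t0 + l} q \<le> e * l"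
    and x1_le: "\<And>t. t \<in> {t0..t0 + l} \<Longrightarrow> norm (block I (x t)) \<le> q t"
    and G_le: "\<And>t. t \<in> {t0..t0 + l} \<Longrightarrow> norm (G (t, x t)) \<le> q t"
    and F2_le: "\<And>t. t \<in> {t0..t0 + l} \<Longrightarrow> norm (block (- I) (F (t, x t))) \<le> q t"
    and G_block: "\<And>t z. G (t, block (- I) z) = G (t, z)"
    and G_int: "\<And>z a b. (\<lambda>t. norm (G (t, z))) integrable_on {a..b}"
    and pe: "\<And>t z. \<lbrakk>block I z = 0; \<delta> / 2 \<le> norm z; norm z \<le> r\<rbrakk> \<Longrightarrow>
               \<mu> \<le> integral {t..t + l} (\<lambda>\<tau>. norm (G (\<tau>, z)))"
    and lip: "\<And>t y z. \<lbrakk>block I z = 0; \<delta> / 2 \<le> norm z; norm z \<le> r; norm (y - z) \<le> d\<rbrakk> \<Longrightarrow>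
               norm (G (t, y) - G (t, z)) \<le> L * norm (y - z)"
    and L: "L \<ge> 0" and e: "e > 0" "2 * e + e * l \<le> \<delta> / 2" "e * l \<le> d" "e * l + L * (e * l) * l < \<mu>"
  shows "\<exists>t\<in>{t0..t0 + l}. norm (x t) < \<delta>"
proof (rule ccontr)
  assume "\<not> ?thesis"
  then have far: "norm (x t) \<ge> \<delta>" if "t \<in> {t0..t0 + l}" for t using that by force
  have Jsub: "{t0..t0 + l} \<subseteq> J"
    using sol J by (rule Icc_subset_solution_domain)
  have x_t0: "x t0 = x0"
    using sol by (auto simp: solution_def)
  have q0: "0 \<le> q t" if "t \<in> {t0..t0 + l}" for t
    using x1_le[OF that] norm_ge_zero order_trans by blast
  have qi: "q integrable_on {t0..t0 + l}" using q by (rule integrable_continuous_real)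
  have drift: "norm (block (- I) (x t) - block (- I) x0) \<le> e * l" if t: "t \<in> {t0..t0 + l}" for t
  proof -
    have F_int: "(\<lambda>s. F (s, x s)) integrable_on {t0..t}" and x_eq: "x t = x0 + integral {t0..t} (\<lambda>s. F (s, x s))"
      using sol Jsub t unfolding solution_def absolutely_integrable_on_def by blast+
    interpret B: bounded_linear "block (- I) :: real ^ 'n \<Rightarrow> real ^ 'n" by (rule bounded_linear_block)
    have "block (- I) (x t) - block (- I) x0 = integral {t0..t} (\<lambda>s. block (- I) (F (s, x s)))"
      using integral_linear[OF F_int bounded_linear_block, of "- I"] by (simp add: x_eq B.add o_def)
    also have "norm \<dots> \<le> integral {t0..t} q"
    proof (rule integral_norm_bound_integral)
      show "(\<lambda>s. block (- I) (F (s, x s))) integrable_on {t0..t}"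
        using integrable_linear[OF F_int bounded_linear_block, of "- I"] by (simp add: o_def)
      show "q integrable_on {t0..t}"
        by (rule integrable_subinterval_real[OF qi]) (use t in auto)
    qed (use F2_le t in auto)
    also have "\<dots> \<le> integral {t0..t0 + l} q"
      by (rule integral_subset_le) (use t q0 in \<open>auto intro: qi integrable_subinterval_real[OF qi]\<close>)
    finally show ?thesis using q_le by linarith
  qed
  have "\<exists>s\<in>{t0..t0 + l}. norm (block I (x s)) \<le> 2 * e"
  proof (rule ccontr)
    assume "\<not> ?thesis"
    then have "2 * e \<le> q t" if "t \<in> {t0..t0 + l}" for t using x1_le[OF that] that by force
    then have "integral {t0..t0 + l} (\<lambda>_. 2 * e) \<le> integral {t0..t0 + l} q"
      by (intro integral_le qi) auto
    then show False using q_le mult_pos_pos[OF e(1) l] l by (simp add: mult_ac)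
  qed
  then obtain s where s: "s \<in> {t0..t0 + l}" "norm (block I (x s)) \<le> 2 * e" by blast
  define z where "z = block (- I) x0"
  have z0: "block I z = 0" by (simp add: z_def block_block block_empty)
  have zr: "norm z \<le> r" using x_le[of t0] norm_block_le[of "- I" x0] l by (simp add: x_t0 z_def)
  have "\<delta> \<le> norm (block I (x s)) + norm (block (- I) (x s))"
    using far[OF s(1)] norm_triangle_ineq[of "block I (x s)" "block (- I) (x s)"]
    by (simp add: block_add_block_Compl)
  moreover have "norm (block (- I) (x s)) \<le> e * l + norm z"
    using drift[OF s(1)] norm_triangle_sub[of "block (- I) (x s)" z] by (simp add: z_def)
  ultimately have zd: "\<delta> / 2 \<le> norm z" using s(2) e(2) by linarith
  have "\<mu> \<le> integral {t0..t0 + l} (\<lambda>\<tau>. norm (G (\<tau>, z)))" by (rule pe[OF z0 zd zr])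
  also have "\<dots> \<le> integral {t0..t0 + l} (\<lambda>t. q t + L * (e * l))"
  proof (rule integral_le[OF G_int])
    show "(\<lambda>t. q t + L * (e * l)) integrable_on {t0..t0 + l}"
      by (intro integrable_add qi) auto
    fix t assume t: "t \<in> {t0..t0 + l}"
    have dz: "norm (block (- I) (x t) - z) \<le> e * l" using drift[OF t] by (simp add: z_def)
    have "norm (G (t, block (- I) (x t)) - G (t, z)) \<le> L * norm (block (- I) (x t) - z)"
      using dz e(3) by (intro lip z0 zd zr) auto
    also have "\<dots> \<le> L * (e * l)" using dz L by (rule mult_left_mono)
    finally have "norm (G (t, x t) - G (t, z)) \<le> L * (e * l)" by (simp add: G_block)
    then show "norm (G (t, z)) \<le> q t + L * (e * l)"
      using G_le[OF t] norm_triangle_sub[of "G (t, z)" "G (t, x t)"]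
      by (simp add: norm_minus_commute)
  qed
  also have "\<dots> = integral {t0..t0 + l} q + L * (e * l) * l"
    using l by (subst integral_add[OF qi]) auto
  finally show False using q_le e(4) by linarith
qed

section \<open>Uniform attractivity\<close>

theorem theorem2:
  fixes F :: "real \<times> (real ^ 'n::finite) \<Rightarrow> (real ^ 'n)"
    and I :: "'n set"
    and K :: "'m::finite set"
    and j :: nat
  assumes "caratheodory F"
    and "solutions_exist F"
    and "UGS F"
    and "j > 0"
    and "\<And>\<Delta>. \<Delta> > 0 \<Longrightarrow>
      \<exists>\<mu>>0. \<exists>(V :: nat \<Rightarrow> real \<times> (real ^ 'n) \<Rightarrow> real) (\<phi> :: real \<times> (real ^ 'n) \<Rightarrow> (real ^ 'm))
         (Y :: nat \<Rightarrow> (real ^ 'n) \<times> (real ^ 'm) \<Rightarrow> real) (\<rho> :: (real ^ 'n) \<times> (real ^ 'm) \<Rightarrow> real).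
        (\<forall>i\<in>{1..j}. locally_lipschitz (V i)) \<and>
        continuous_on UNIV \<phi> \<and>
        (\<forall>i\<in>{1..j}. continuous_on UNIV (Y i)) \<and>
        (\<forall>i\<in>{1..j}. AE (t, x) in lebesgue. x \<in> cball 0 \<Delta> \<longrightarrow>
           max \<bar>V i (t, x)\<bar> (norm (\<phi> (t, x))) \<le> \<mu> \<and>
           V i differentiable at (t, x) \<and>
           orbital_derivative F (V i) (t, x) \<le> Y i (x, \<phi> (t, x))) \<and>
        (\<forall>k\<in>{1..j}. \<forall>z\<in>cball 0 \<Delta>. \<forall>\<psi>\<in>cball 0 \<mu>.
           (\<forall>i\<in>{1..<k}. Y i (z, \<psi>) = 0) \<longrightarrow> Y k (z, \<psi>) \<le> 0) \<and>
        (\<forall>z\<in>cball 0 \<Delta>. \<forall>\<psi>\<in>cball 0 \<mu>.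
           (\<forall>i\<in>{1..j}. Y i (z, \<psi>) = 0) \<longrightarrow> block I z = 0 \<and> block K \<psi> = 0) \<and>
        (\<forall>t x y. block (- I) x = block (- I) y \<longrightarrow> block K (\<phi> (t, x)) = block K (\<phi> (t, y))) \<and>
        locally_lipschitz_uniformly (\<lambda>p. block K (\<phi> p)) \<and>
        u_delta_PE (- I) (\<lambda>p. block K (\<phi> p)) \<and>
        (\<forall>t. block K (\<phi> (t, 0)) = 0) \<and>
        continuous_on UNIV \<rho> \<and> \<rho> (0, 0) = 0 \<and>
        (\<forall>t. \<forall>x\<in>cball 0 \<Delta>. norm (block (- I) (F (t, x))) \<le> \<rho> (block I x, block K (\<phi> (t, x))))"
  shows "UGAS F"
proof -
  note car = assms(1) and stable = assms(3) and jpos = assms(4) and data = assms(5)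
  obtain \<gamma> where \<gamma>: "class_K_infinity \<gamma>" and stab: "\<And>t0 x0 J x t. solution F J t0 x0 x \<Longrightarrow> t \<in> J \<Longrightarrow> norm (x t) \<le> \<gamma> (norm x0)"
    using stable unfolding UGS_def by blast
  have \<gamma>_mono: "\<gamma> s \<le> \<gamma> s'" if "0 \<le> s" "s \<le> s'" for s s'
    using \<gamma> that strict_mono_on_leD[of "{0..}" \<gamma> s s'] by (auto simp: class_K_infinity_def)
  have "uniformly_globally_attractive F"
    unfolding uniformly_globally_attractive_def
  proof (intro allI impI)
    fix r0 \<sigma> :: real assume r0: "r0 > 0" and \<sigma>: "\<sigma> > 0"
    \<comment> \<open>Reaching norm \<open>\<delta>\<close> once suffices: uniform stability then confines the solution to norm \<open>\<sigma>\<close>.\<close>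
    obtain \<delta> where \<delta>: "\<delta> > 0" "\<gamma> \<delta> \<le> \<sigma>"
    proof -
      have "continuous_on {0..} \<gamma>" "\<gamma> 0 = 0" using \<gamma> by (auto simp: class_K_infinity_def)
      then obtain d where d: "d > 0" "\<And>s. s \<in> {0..} \<Longrightarrow> dist s 0 < d \<Longrightarrow> dist (\<gamma> s) 0 < \<sigma>"
        using \<sigma> unfolding continuous_on_iff by (metis atLeast_iff order_refl)
      have "\<gamma> (d / 2) < \<sigma>" using d(1) d(2)[of "d / 2"] by (simp add: dist_real_def)
      then show ?thesis using that[of "d / 2"] d(1) by simp
    qed
    define r where "r = \<gamma> r0"
    have r: "0 \<le> r" using \<gamma>_mono[of 0 r0] \<gamma> r0 by (simp add: r_def class_K_infinity_def)
    \<comment> \<open>The solutions stay in the ball of radius \<open>r\<close>; the objects are needed on a slightly larger ball.\<close>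
    define R where "R = r + 1"
    have R: "R > 0" "r < R" using r by (auto simp: R_def)
    obtain \<mu> and V :: "nat \<Rightarrow> real \<times> (real ^ 'n) \<Rightarrow> real" and \<phi> :: "real \<times> (real ^ 'n) \<Rightarrow> (real ^ 'm)"
         and Y :: "nat \<Rightarrow> (real ^ 'n) \<times> (real ^ 'm) \<Rightarrow> real" and \<rho> :: "(real ^ 'n) \<times> (real ^ 'm) \<Rightarrow> real"
      where \<mu>: "\<mu> > 0" and
        objects: "(\<forall>i\<in>{1..j}. locally_lipschitz (V i)) \<and>
        continuous_on UNIV \<phi> \<and>
        (\<forall>i\<in>{1..j}. continuous_on UNIV (Y i)) \<and>
        (\<forall>i\<in>{1..j}. AE (t, x) in lebesgue. x \<in> cball 0 R \<longrightarrow>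
           max \<bar>V i (t, x)\<bar> (norm (\<phi> (t, x))) \<le> \<mu> \<and>
           V i differentiable at (t, x) \<and>
           orbital_derivative F (V i) (t, x) \<le> Y i (x, \<phi> (t, x))) \<and>
        (\<forall>k\<in>{1..j}. \<forall>z\<in>cball 0 R. \<forall>\<psi>\<in>cball 0 \<mu>.
           (\<forall>i\<in>{1..<k}. Y i (z, \<psi>) = 0) \<longrightarrow> Y k (z, \<psi>) \<le> 0) \<and>
        (\<forall>z\<in>cball 0 R. \<forall>\<psi>\<in>cball 0 \<mu>.
           (\<forall>i\<in>{1..j}. Y i (z, \<psi>) = 0) \<longrightarrow> block I z = 0 \<and> block K \<psi> = 0) \<and>
        (\<forall>t x y. block (- I) x = block (- I) y \<longrightarrow> block K (\<phi> (t, x)) = block K (\<phi> (t, y))) \<and>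
        locally_lipschitz_uniformly (\<lambda>p. block K (\<phi> p)) \<and>
        u_delta_PE (- I) (\<lambda>p. block K (\<phi> p)) \<and>
        (\<forall>t. block K (\<phi> (t, 0)) = 0) \<and>
        continuous_on UNIV \<rho> \<and> \<rho> (0, 0) = 0 \<and>
        (\<forall>t. \<forall>x\<in>cball 0 R. norm (block (- I) (F (t, x))) \<le> \<rho> (block I x, block K (\<phi> (t, x))))"
      by (insert data[OF R(1)], erule exE, erule conjE, (erule exE)+, erule that, assumption)
    have V: "\<And>i. i \<in> {1..j} \<Longrightarrow> locally_lipschitz (V i)"
      and \<phi>: "continuous_on UNIV \<phi>"
      and Y: "\<And>i. i \<in> {1..j} \<Longrightarrow> continuous_on UNIV (Y i)"
      and ae: "\<And>i. i \<in> {1..j} \<Longrightarrow> AE p in lebesgue. snd p \<in> cball 0 R \<longrightarrow>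
           (\<bar>V i p\<bar> \<le> \<mu> \<and> norm (\<phi> p) \<le> \<mu>) \<and>
           V i differentiable at p \<and> orbital_derivative F (V i) p \<le> Y i (snd p, \<phi> p)"
      and nested: "\<And>k z \<psi>. \<lbrakk>k \<in> {1..j}; z \<in> cball 0 R; \<psi> \<in> cball 0 \<mu>; \<forall>i\<in>{1..<k}. Y i (z, \<psi>) = 0\<rbrakk>
           \<Longrightarrow> Y k (z, \<psi>) \<le> 0"
      and all_zero: "\<And>z \<psi>. \<lbrakk>z \<in> cball 0 R; \<psi> \<in> cball 0 \<mu>; \<forall>i\<in>{1..j}. Y i (z, \<psi>) = 0\<rbrakk>
           \<Longrightarrow> block I z = 0 \<and> block K \<psi> = 0"
      and indep: "\<And>t x y. block (- I) x = block (- I) y \<Longrightarrow> block K (\<phi> (t, x)) = block K (\<phi> (t, y))"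
      and lip: "locally_lipschitz_uniformly (\<lambda>p. block K (\<phi> p))"
      and pe: "u_delta_PE (- I) (\<lambda>p. block K (\<phi> p))"
      and \<rho>: "continuous_on UNIV \<rho>" "\<rho> (0, 0) = 0"
      and F2: "\<And>t x. x \<in> cball 0 R \<Longrightarrow> norm (block (- I) (F (t, x))) \<le> \<rho> (block I x, block K (\<phi> (t, x)))"
      using objects unfolding case_prod_beta' prod.collapse max.bounded_iff by blast+
    have V_le: "\<bar>V i (t, z)\<bar> \<le> \<mu>" if "i \<in> {1..j}" "norm z \<le> r" for i t z
    proof (rule AE_bound_imp_bound_on_ball[where f="\<lambda>p. \<bar>V i p\<bar>"])
      show "AE p in lebesgue. snd p \<in> cball 0 R \<longrightarrow> \<bar>V i p\<bar> \<le> \<mu>"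
        using ae[OF that(1)] by (rule eventually_mono) blast
      show "continuous_on UNIV (\<lambda>p. \<bar>V i p\<bar>)"
        by (intro continuous_on_rabs locally_lipschitz_continuous_on V that)
    qed (use that R(2) in simp)
    have \<phi>_le: "norm (\<phi> (t, z)) \<le> \<mu>" if "norm z \<le> r" for t z
    proof (rule AE_bound_imp_bound_on_ball[where f="\<lambda>p. norm (\<phi> p)"])
      have "1 \<in> {1..j}" using jpos by simp
      from ae[OF this] show "AE p in lebesgue. snd p \<in> cball 0 R \<longrightarrow> norm (\<phi> p) \<le> \<mu>"
        by (rule eventually_mono) blast
      show "continuous_on UNIV (\<lambda>p. norm (\<phi> p))" using \<phi> by (rule continuous_on_norm)
    qed (use that R(2) in simp)
    have orb: "AE p in lebesgue. snd p \<in> cball 0 R \<longrightarrow>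
           V i differentiable at p \<and> orbital_derivative F (V i) p \<le> Y i (snd p, \<phi> p)" if "i \<in> {1..j}" for i
      using ae[OF that] by (rule eventually_mono) blast
    \<comment> \<open>The second blocks of states that are in reach and not yet small.\<close>
    define C where "C = {z :: real ^ 'n. block I z = 0 \<and> \<delta> / 2 \<le> norm z \<and> norm z \<le> r}"
    have C: "compact C"
    proof -
      have "closed ({z. block I z = (0 :: real ^ 'n)} \<inter> {z. \<delta> / 2 \<le> norm z})"
        by (intro closed_Int closed_Collect_eq closed_Collect_le continuous_intros)
      moreover have "C = cball 0 r \<inter> ({z. block I z = 0} \<inter> {z. \<delta> / 2 \<le> norm z})"
        by (auto simp: C_def)
      ultimately show ?thesis by (simp only: compact_Int_closed[OF compact_cball])
    qed
    have C_nz: "block (- I) z \<noteq> 0" if "z \<in> C" for z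
      using that block_add_block_Compl[of I z] \<delta>(1) by (auto simp: C_def)
    obtain l \<mu>1 d L where l: "l > 0" and \<mu>1: "\<mu>1 > 0" and d: "d > 0" and L: "L \<ge> 0"
      and pe_C: "\<And>t z. z \<in> C \<Longrightarrow> \<mu>1 \<le> integral {t..t + l} (\<lambda>\<tau>. norm (block K (\<phi> (\<tau>, z))))"
      and lip_C: "\<And>t z y. z \<in> C \<Longrightarrow> norm (y - z) \<le> d \<Longrightarrow>
          norm (block K (\<phi> (t, y)) - block K (\<phi> (t, z))) \<le> L * norm (y - z)"
      using uniform_excitation_on_compact[OF pe lip C C_nz] by metis
    \<comment> \<open>Small enough to contradict excitation over one window of length \<open>l\<close>. The window length and the
      constants \<open>d\<close>, \<open>L\<close> and \<open>\<mu>1\<close> come first, so that \<open>e\<close> and the number of windows may depend on them.\<close>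
    define e where "e = min (\<delta> / (2 * (2 + l))) (min (d / l) (\<mu>1 / (2 * l * (1 + L * l))))"
    have Ll: "L * l \<ge> 0" using L l by simp
    have e: "e > 0" using \<delta> l d \<mu>1 Ll by (simp add: e_def add_pos_nonneg)
    have "e \<le> \<delta> / (2 * (2 + l))" "e \<le> d / l" "e \<le> \<mu>1 / (2 * l * (1 + L * l))" by (simp_all add: e_def)
    then have "e * (2 * (2 + l)) \<le> \<delta>" "e * l \<le> d" "e * (2 * l * (1 + L * l)) \<le> \<mu>1"
      using l Ll by (simp_all add: pos_le_divide_eq add_pos_nonneg)
    then have e_small: "2 * e + e * l \<le> \<delta> / 2" "e * l \<le> d" "e * l + L * (e * l) * l < \<mu>1"
      using \<mu>1 by (simp_all add: algebra_simps)
    define g where "g p = norm (block I (fst p)) + norm (block K (snd p)) + \<bar>\<rho> (block I (fst p), block K (snd p))\<bar>" for p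
    have g: "continuous_on S g" for S
      unfolding g_def by (intro continuous_intros continuous_on_compose2[OF \<rho>(1)]) auto
    define D where "D = cball (0 :: real ^ 'n) R \<times> cball (0 :: real ^ 'm) \<mu>"
    obtain c where c: "\<And>i. c i \<ge> 0" "\<And>q. q \<in> D \<Longrightarrow> g q + (\<Sum>i\<in>{1..j}. c i * Y i q) < e / 2"
    proof -
      have "\<exists>c. (\<forall>i. c i \<ge> 0) \<and> (\<forall>q\<in>D. g q + (\<Sum>i\<in>{1..j}. c i * Y i q) < e / 2)"
      proof (rule nested_penalty)
        show "compact D" unfolding D_def by (intro compact_Times compact_cball)
        show "continuous_on D g" by (rule g)
        show "continuous_on D (Y i)" if "i \<in> {1..j}" for i
          using Y[OF that] by (rule continuous_on_subset) simp
        show "Y k q \<le> 0" if "k \<in> {1..j}" "q \<in> D" "\<forall>i\<in>{1..<k}. Y i q = 0" for k q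
          using nested[of k "fst q" "snd q"] that by (auto simp: D_def)
        show "g q < e / 2" if "q \<in> D" "\<forall>i\<in>{1..j}. Y i q = 0" for q
          using all_zero[of "fst q" "snd q"] that e \<rho>(2) by (auto simp: D_def g_def)
      qed
      then show ?thesis using that by blast
    qed
    \<comment> \<open>The total decrease that the functions \<open>V i\<close> allow; \<open>n\<close> windows suffice to make it negligible on
      average.\<close>
    define B where "B = 2 * \<mu> * (\<Sum>i\<in>{1..j}. c i)"
    obtain n :: nat where n: "B / (e / 2 * l) < real n" using reals_Archimedean2 by blast
    have B0: "0 \<le> B" unfolding B_def using \<mu> c(1) by (simp add: sum_nonneg)
    have "0 \<le> B / (e / 2 * l)" using B0 e l by simp
    then have npos: "n > 0" using n by (cases n) auto
    have nB: "B \<le> e / 2 * (real n * l)"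
      using n e l by (simp add: pos_divide_less_eq mult_ac)
    have visit: "\<exists>t\<in>{t0..t0 + real n * l}. norm (x t) < \<delta>"
      if sol: "solution F J t0 x0 x" and x0: "norm x0 \<le> r0" and J: "t0 + real n * l \<in> J" for t0 x0 J x
    proof -
      let ?b = "t0 + real n * l"
      have Jsub: "{t0..?b} \<subseteq> J"
        using sol J by (rule Icc_subset_solution_domain)
      have x_le: "norm (x t) \<le> r" if "t \<in> J" for t
        using stab[OF sol that] \<gamma>_mono[OF norm_ge_zero x0] by (simp add: r_def)
      define q where "q s = g (x s, \<phi> (s, x s))" for s
      have q: "continuous_on {t0..?b} q"
        unfolding q_def
        by (intro continuous_on_compose2[OF g[of UNIV]] continuous_on_compose2[OF \<phi>] continuous_intros
            solution_continuous_on[OF sol J]) auto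
      have "integral {t0..?b} q \<le> e / 2 * (?b - t0) + B"
        unfolding q_def B_def
      proof (rule integral_dissipation_bound[OF car sol J _ R(2) V \<phi> Y orb V_le \<phi>_le g c(1)])
        show "norm (x t) \<le> r" if "t \<in> {t0..?b}" for t using x_le Jsub that by blast
        show "g (z, \<psi>) + (\<Sum>i\<in>{1..j}. c i * Y i (z, \<psi>)) \<le> e / 2" if "norm z \<le> r" "norm \<psi> \<le> \<mu>" for z \<psi>
          using c(2)[of "(z, \<psi>)"] that R(2) by (auto simp: D_def)
      qed
      then have "integral {t0..?b} q \<le> e * (real n * l)" using nB by simp
      then obtain s where s: "t0 \<le> s" "s + l \<le> ?b" "integral {s..s + l} q \<le> e * l"
        using exists_window_small_integral[OF integrable_continuous_real[OF q] l npos] by blast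
      have sub: "{s..s + l} \<subseteq> {t0..?b}" using s by auto
      have sJ: "s \<in> J" using sub Jsub l by auto
      have "\<exists>t\<in>{s..s + l}. norm (x t) < \<delta>"
      proof (rule excited_solution_visits_ball[where G="\<lambda>p. block K (\<phi> p)" and I=I and q=q and r=r
              and L=L and d=d and \<mu>=\<mu>1 and e=e])
        show "solution F (J \<inter> {s..}) s (x s) x" using sol sJ by (rule solution_restart)
        show "s + l \<in> J \<inter> {s..}" using sub Jsub l by auto
        show "continuous_on {s..s + l} q" using q sub by (rule continuous_on_subset)
        fix t assume "t \<in> {s..s + l}"
        then have t: "norm (x t) \<le> r" using sub Jsub x_le by blast
        then show "norm (x t) \<le> r" .
        show "norm (block I (x t)) \<le> q t" "norm (block K (\<phi> (t, x t))) \<le> q t"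
          by (simp_all add: q_def g_def)
        show "norm (block (- I) (F (t, x t))) \<le> q t"
          using F2[of "x t" t] t R(2) abs_ge_self[of "\<rho> (block I (x t), block K (\<phi> (t, x t)))"]
            norm_ge_zero[of "block I (x t)"] norm_ge_zero[of "block K (\<phi> (t, x t))"]
          unfolding q_def g_def fst_conv snd_conv mem_cball_0 by linarith
      next
        show "block K (\<phi> (t, block (- I) z)) = block K (\<phi> (t, z))" for t z
          by (rule indep) (simp add: block_block)
        show "(\<lambda>t. norm (block K (\<phi> (t, z)))) integrable_on {a..b}" for z a b
          using pe unfolding u_delta_PE_def absolutely_integrable_on_def by blast
      qed (use pe_C lip_C l L e e_small s in \<open>auto simp: C_def\<close>)
      then show ?thesis using sub by blast
    qed
    show "\<exists>T>0. \<forall>t0 x0 J x. solution F J t0 x0 x \<and> norm x0 \<le> r0 \<longrightarrow>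
        (\<forall>t\<in>J. t \<ge> t0 + T \<longrightarrow> norm (x t) \<le> \<sigma>)"
    proof (intro exI[of _ "real n * l"] conjI allI impI ballI)
      show "0 < real n * l" using npos l by simp
      fix t0 x0 J x t
      assume "solution F J t0 x0 x \<and> norm x0 \<le> r0" and t: "t \<in> J" "t0 + real n * l \<le> t"
      then have sol: "solution F J t0 x0 x" and x0: "norm x0 \<le> r0" by auto
      have Jsub: "{t0..t} \<subseteq> J"
        using sol t(1) by (rule Icc_subset_solution_domain)
      have "t0 + real n * l \<in> J" using Jsub t(2) npos l by auto
      then obtain s where s: "s \<in> {t0..t0 + real n * l}" "norm (x s) < \<delta>"
        using visit[OF sol x0] by blast
      then have "s \<in> J" using Jsub t(2) by auto
      from stab[OF solution_restart[OF sol this], of t]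
      have "norm (x t) \<le> \<gamma> (norm (x s))" using s(1) t by auto
      also have "\<dots> \<le> \<gamma> \<delta>" using s(2) by (intro \<gamma>_mono) auto
      finally show "norm (x t) \<le> \<sigma>" using \<delta>(2) by simp
    qed
  qed
  then show ?thesis using stable by (simp add: UGAS_def)
qed

end
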